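(* Let $\mathbf{X}$ be a computably admissible, computably compact Hausdorff represented space admitting a proper computable dyadic subbase. Then there exist a representation $\delta :\subseteq \{0,1\}^\omega \to \mathbf{X}$ of $\mathbf{X}$ and a $\mathbb{T}^\omega$-representation $\psi :\subseteq \mathbb{T}^\omega \to \mathcal{K}(\mathbf{X})$ of $\mathcal{K}(\mathbf{X})$ which match, i.e.\ for all $A \in \mathcal{K}(\mathbf{X})$ and all $x \in \mathbf{X}$: $$x \in A \iff \forall p \in \psi^{-1}(A)\ \exists q \in \{0,1\}^\omega\ (p \preceq q \wedge \delta(q) = x) \iff \exists p \in \psi^{-1}(A)\ \exists q \in \{0,1\}^\omega\ (p \preceq q \wedge \delta(q) = x).$$
   Context: A represented space is a pair $\mathbf{X}=(X,\delta_X)$ with $\delta_X :\subseteq \{0,1\}^\omega \to X$ a partial surjection. A (multivalued) map $f :\subseteq \mathbf{X} \rightrightarrows \mathbf{Y}$ is computable (continuous) if some computable (continuous) $F :\subseteq \{0,1\}^\omega \to \{0,1\}^\omega$ satisfies $\delta_Y(F(p)) \in f(\delta_X(p))$ for all $p \in \operatorname{dom}(f\circ\delta_X)$. Sierpiński space $\mathbb{S}=\{\bot,\top\}$ has $\delta_\mathbb{S}(0^\omega)=\bot$ and $\delta_\mathbb{S}(p)=\top$ for $p\neq 0^\omega$. $\mathcal{C}(\mathbf{X},\mathbf{Y})$ denotes the continuous functions with the standard function-space representation (for which evaluation and composition are computable). $\mathcal{O}(\mathbf{X})$: open sets $U$ represented via $\chi_U \in \mathcal{C}(\mathbf{X},\mathbb{S})$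 ($\chi_U(x)=\top$ iff $x\in U$); the topology of $\mathbf{X}$ is the final topology of $\delta_X$ (whose open sets are those in $\mathcal{O}(\mathbf{X})$), and "Hausdorff" refers to it. $\mathcal{A}(\mathbf{X})$: closed sets $A$ represented by a $\mathcal{O}(\mathbf{X})$-name of $X\setminus A$. $\mathcal{K}(\mathbf{X})$: compact sets $A$ represented by $\{U \in \mathcal{O}(\mathbf{X}) \mid A \subseteq U\} \in \mathcal{O}(\mathcal{O}(\mathbf{X}))$. $\mathbf{X}$ is computably compact if $\mathrm{isEmpty}: \mathcal{A}(\mathbf{X}) \to \mathbb{S}$ (with value $\top$ exactly on $\emptyset$) is computable. $\mathbf{X}$ is computably admissible if $x \mapsto \{U \in \mathcal{O}(\mathbf{X}) \mid x \in U\}$, $\mathbf{X} \to \mathcal{O}(\mathcal{O}(\mathbf{X}))$, is injective with computable partial inverse. Plotkin's $\mathbb{T}=\{0,1,\bot\}$ (topology generated by $\{\{0\},\{1\}\}$) is represented by $\delta_\mathbb{T}(0^\omega)=\bot$, $\delta_\mathbb{T}(p)=0$ if $\min\{n \mid p(n)=1\}$ is even and $=1$ if it is odd; $\mathbb{T}^\omega$ carries the induced product representation $\delta_{\mathbb{T}^\omega}$. A $\mathbb{T}^\omega$-representation of a set $Y$ is a partial surjection $\psi :\subseteq \mathbb{T}^\omega \to Y$. For $p,q \in \mathbb{T}^\omega$, $p \preceq q$ means $p(n)\neq\bot \Rightarrow p(n)=q(n)$ for all $n$; $\{0,1\}^\omega \subseteq \mathbb{T}^\omega$. A representation of the represented space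 $\mathbf{X}$ means a representation computably equivalent to $\delta_X$ (identity computable in both directions); a $\mathbb{T}^\omega$-representation $\psi$ of $\mathcal{K}(\mathbf{X})$ means one for which $\psi\circ\delta_{\mathbb{T}^\omega}$ is computably equivalent to the standard representation of $\mathcal{K}(\mathbf{X})$. A dyadic subbase of $\mathbf{X}$ is a map $S:\mathbb{N}\times\{0,1\}\to\mathcal{O}(\mathbf{X})$, $(n,i)\mapsto S_{n,i}$, whose image is a subbase of the topology of $\mathbf{X}$ and with $S_{n,0}\cap S_{n,1}=\emptyset$ for all $n$. Let $S_{n,\bot}=X\setminus(S_{n,0}\cup S_{n,1})$ and $\varphi_S:X\to\mathbb{T}^\omega$, $\varphi_S(x)(n)=a$ iff $x\in S_{n,a}$ ($a\in\{0,1,\bot\}$). $S$ is computable if $S$ is computable and $\varphi_S$ as well as its partial inverse are computable (with $\mathbb{T}^\omega$ represented by $\delta_{\mathbb{T}^\omega}$). For $p\in\mathbb{T}^\omega$ let $\operatorname{dom}(p)=\{k\mid p(k)\neq\bot\}$, $S(p)=\bigcap_{k\in\operatorname{dom}(p)}S_{k,p(k)}$ and $\bar S(p)=\bigcap_{k\in\operatorname{dom}(p)}(X\setminus S_{k,1-p(k)})$. A finite sequence $e$ over $\mathbb{T}$ is identified with $e\bot^\omega$. $S$ is proper if $\mathrm{cl}\,S(e)=\bar S(e)$ for every finite sequence $e$ over $\mathbb{T}$. *)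

theory Defs
  imports "HOL-Analysis.Analysis" "HOL-Library.Nat_Bijection" "HOL-Library.FuncSet"
begin

section \<open>Computability on Cantor space\<close>

type_synonym cantor = "nat \<Rightarrow> bool"

definition minimize :: "(nat \<Rightarrow> nat option) \<Rightarrow> nat option" where
  "minimize g =
     (if \<exists>n. g n = Some 0 \<and> (\<forall>m<n. \<exists>v. g m = Some (Suc v))
      then Some (LEAST n. g n = Some 0) else None)"

text \<open>
  Kleene's partial recursive functionals: the partial functions on \<open>\<nat>\<close> that are partial recursive
  relative to an oracle \<open>p\<close>, uniformly in \<open>p\<close>. They are unary; several arguments are passed through
  the Cantor pairing function.
\<close>

inductive partial_recursive :: "(cantor \<Rightarrow> nat \<Rightarrow> nat option) \<Rightarrow> bool" where
  pr_zero: "partial_recursive (\<lambda>p n. Some 0)"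
| pr_succ: "partial_recursive (\<lambda>p n. Some (Suc n))"
| pr_fst: "partial_recursive (\<lambda>p n. Some (fst (prod_decode n)))"
| pr_snd: "partial_recursive (\<lambda>p n. Some (snd (prod_decode n)))"
| pr_oracle: "partial_recursive (\<lambda>p n. Some (of_bool (p n)))"
| pr_pair: "partial_recursive f \<Longrightarrow> partial_recursive g \<Longrightarrow>
    partial_recursive (\<lambda>p n. Option.bind (f p n) (\<lambda>a.
      Option.bind (g p n) (\<lambda>b. Some (prod_encode (a, b)))))"
| pr_comp: "partial_recursive f \<Longrightarrow> partial_recursive g \<Longrightarrow>
    partial_recursive (\<lambda>p n. Option.bind (g p n) (f p))"
| pr_rec: "partial_recursive f \<Longrightarrow> partial_recursive g \<Longrightarrow>
    partial_recursive (\<lambda>p c. case prod_decode c of (a, n) \<Rightarrow>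
      rec_nat (f p a)
        (\<lambda>k r. Option.bind r (\<lambda>v. g p (prod_encode (a, prod_encode (k, v))))) n)"
| pr_min: "partial_recursive f \<Longrightarrow>
    partial_recursive (\<lambda>p a. minimize (\<lambda>n. f p (prod_encode (a, n))))"

text \<open>The functional may converge outside the domain of \<open>F\<close>: restrictions of computable partial
  functions count as computable.\<close>

definition computable :: "(cantor \<rightharpoonup> cantor) \<Rightarrow> bool" where
  "computable F \<longleftrightarrow>
     (\<exists>\<Phi>. partial_recursive \<Phi> \<and>
          (\<forall>p q. F p = Some q \<longrightarrow> (\<forall>n. \<Phi> p n = Some (of_bool (q n)))))"


section \<open>Represented spaces\<close>

text \<open>A represented space is given by its representation; its underlying set is the range.\<close>

type_synonym 'a rspace = "cantor \<rightharpoonup> 'a"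

definition realizes ::
  "(cantor \<rightharpoonup> cantor) \<Rightarrow> 'a rspace \<Rightarrow> 'b rspace \<Rightarrow> ('a \<rightharpoonup> 'b) \<Rightarrow> bool" where
  "realizes F X Y f \<longleftrightarrow>
     (\<forall>p x y. X p = Some x \<longrightarrow> f x = Some y \<longrightarrow> (\<exists>q. F p = Some q \<and> Y q = Some y))"

definition computable_map :: "'a rspace \<Rightarrow> 'b rspace \<Rightarrow> ('a \<rightharpoonup> 'b) \<Rightarrow> bool" where
  "computable_map X Y f \<longleftrightarrow> (\<exists>F. computable F \<and> realizes F X Y f)"

definition rep_equiv :: "'a rspace \<Rightarrow> 'a rspace \<Rightarrow> bool" where
  "rep_equiv X Y \<longleftrightarrow> computable_map X Y Some \<and> computable_map Y X Some"

definition partial_inverse :: "'a set \<Rightarrow> ('a \<Rightarrow> 'b) \<Rightarrow> ('b \<rightharpoonup> 'a)" where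
  "partial_inverse A f y = (if y \<in> f ` A then Some (inv_into A f y) else None)"

text \<open>The final topology of the representation.\<close>

definition rtop :: "'a rspace \<Rightarrow> 'a topology" where
  "rtop X = topology (\<lambda>U. U \<subseteq> ran X \<and>
     openin (top_of_set (dom X)) {p \<in> dom X. the (X p) \<in> U})"

definition nat_rep :: "nat rspace" where
  "nat_rep p = (if \<exists>n. p n then Some (LEAST n. p n) else None)"

definition bit_rep :: "bool rspace" where
  "bit_rep p = Some (p 0)"

definition prod_rep :: "'a rspace \<Rightarrow> 'b rspace \<Rightarrow> ('a \<times> 'b) rspace" where
  "prod_rep X Y p =
     Option.bind (X (\<lambda>n. p (2 * n))) (\<lambda>x.
       Option.bind (Y (\<lambda>n. p (2 * n + 1))) (\<lambda>y. Some (x, y)))"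

definition seq_rep :: "'a rspace \<Rightarrow> (nat \<Rightarrow> 'a) rspace" where
  "seq_rep X p =
     (if \<forall>n. (\<lambda>m. p (prod_encode (n, m))) \<in> dom X
      then Some (\<lambda>n. the (X (\<lambda>m. p (prod_encode (n, m))))) else None)"

text \<open>Sierpinski space, with \<^const>\<open>True\<close> as the open point \<open>\<top>\<close>.\<close>

definition sierpinski :: "bool rspace" where
  "sierpinski p = Some (\<exists>n. p n)"


section \<open>Function spaces and hyperspaces\<close>

text \<open>The word \<open>p(0) \<dots> p(k-1)\<close> is coded by the number with binary numeral \<open>1 p(0) \<dots> p(k-1)\<close>.\<close>

primrec prefix_code :: "cantor \<Rightarrow> nat \<Rightarrow> nat" where
  "prefix_code p 0 = 1"
| "prefix_code p (Suc k) = 2 * prefix_code p k + of_bool (p k)"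

text \<open>
  The partial continuous function on Cantor space with Kleene associate \<open>q\<close>. To produce the
  \<open>n\<close>-th output bit, longer and longer prefixes \<open>w\<close> of \<open>p\<close> are presented to \<open>q\<close>; the bit of \<open>q\<close> at
  \<open>2\<langle>n,w\<rangle>\<close> tells whether \<open>w\<close> suffices, and if so the bit at \<open>2\<langle>n,w\<rangle> + 1\<close> is the output.
\<close>

definition associate :: "cantor \<Rightarrow> (cantor \<rightharpoonup> cantor)" where
  "associate q p =
     (let c = (\<lambda>n k. prod_encode (n, prefix_code p k)) in
      if \<forall>n. \<exists>k. q (2 * c n k)
      then Some (\<lambda>n. q (2 * c n (LEAST k. q (2 * c n k)) + 1)) else None)"

text \<open>
  Every partial continuous function on Cantor space has an extension of the form
  \<^term>\<open>associate q\<close>, so the functions named below are those with a continuous realizer.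
  They are made unique outside the underlying set of \<open>X\<close> by extensionality.
\<close>

definition function_name :: "'a rspace \<Rightarrow> 'b rspace \<Rightarrow> cantor \<Rightarrow> ('a \<Rightarrow> 'b) \<Rightarrow> bool" where
  "function_name X Y q f \<longleftrightarrow>
     f \<in> extensional (ran X) \<and> realizes (associate q) X Y (\<lambda>x. Some (f x))"

definition function_rep :: "'a rspace \<Rightarrow> 'b rspace \<Rightarrow> ('a \<Rightarrow> 'b) rspace" where
  "function_rep X Y q =
     (if \<exists>f. function_name X Y q f then Some (THE f. function_name X Y q f) else None)"

definition open_rep :: "'a rspace \<Rightarrow> 'a set rspace" where
  "open_rep X q = map_option (\<lambda>f. {x \<in> ran X. f x}) (function_rep X sierpinski q)"

definition closed_rep :: "'a rspace \<Rightarrow> 'a set rspace" where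
  "closed_rep X q = map_option (\<lambda>U. ran X - U) (open_rep X q)"

text \<open>
  The open supersets of a set determine only its saturation, so in general one takes saturated
  compact sets. In a T1 space, hence in a Hausdorff space, every set is saturated.
\<close>

definition compact_name :: "'a rspace \<Rightarrow> cantor \<Rightarrow> 'a set \<Rightarrow> bool" where
  "compact_name X q A \<longleftrightarrow>
     compactin (rtop X) A \<and> A = \<Inter>{U. openin (rtop X) U \<and> A \<subseteq> U} \<and>
     open_rep (open_rep X) q = Some {U \<in> ran (open_rep X). A \<subseteq> U}"

definition compact_rep :: "'a rspace \<Rightarrow> 'a set rspace" where
  "compact_rep X q =
     (if \<exists>A. compact_name X q A then Some (THE A. compact_name X q A) else None)"

definition computably_compact :: "'a rspace \<Rightarrow> bool" where
  "computably_compact X \<longleftrightarrow> computable_map (closed_rep X) sierpinski (\<lambda>A. Some (A = {}))"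

definition nbhd_filter :: "'a rspace \<Rightarrow> 'a \<Rightarrow> 'a set set" where
  "nbhd_filter X x = {U \<in> ran (open_rep X). x \<in> U}"

definition computably_admissible :: "'a rspace \<Rightarrow> bool" where
  "computably_admissible X \<longleftrightarrow>
     inj_on (nbhd_filter X) (ran X) \<and>
     computable_map (open_rep (open_rep X)) X (partial_inverse (ran X) (nbhd_filter X))"


section \<open>Plotkin's \<open>\<bbbT>\<close> and dyadic subbases\<close>

text \<open>The points \<open>\<bottom>, 0, 1\<close> are \<^term>\<open>None\<close>, \<^term>\<open>Some False\<close>, \<^term>\<open>Some True\<close>.\<close>

type_synonym plotkin = "bool option"

definition plotkin_rep :: "plotkin rspace" where
  "plotkin_rep p = Some (if \<exists>n. p n then Some (odd (LEAST n. p n)) else None)"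

definition plotkin_seq_rep :: "(nat \<Rightarrow> plotkin) rspace" where
  "plotkin_seq_rep = seq_rep plotkin_rep"

definition total_seq :: "cantor \<Rightarrow> (nat \<Rightarrow> plotkin)" where
  "total_seq q n = Some (q n)"

definition refines :: "(nat \<Rightarrow> plotkin) \<Rightarrow> (nat \<Rightarrow> plotkin) \<Rightarrow> bool" (infix \<open>\<preceq>\<^sub>T\<close> 50) where
  "p \<preceq>\<^sub>T q \<longleftrightarrow> (\<forall>n. p n \<noteq> None \<longrightarrow> p n = q n)"

definition finite_seq :: "plotkin list \<Rightarrow> (nat \<Rightarrow> plotkin)" where
  "finite_seq e n = (if n < length e then e ! n else None)"

text \<open>The empty intersection of subbasic sets is the whole space, whence the
  \<^term>\<open>insert (ran X)\<close>.\<close>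

definition dyadic_subbase :: "'a rspace \<Rightarrow> (nat \<Rightarrow> bool \<Rightarrow> 'a set) \<Rightarrow> bool" where
  "dyadic_subbase X S \<longleftrightarrow>
     (\<forall>n i. S n i \<in> ran (open_rep X)) \<and>
     rtop X = topology_generated_by (insert (ran X) {S n i | n i. True}) \<and>
     (\<forall>n. S n False \<inter> S n True = {})"

definition subbase_map :: "(nat \<Rightarrow> bool \<Rightarrow> 'a set) \<Rightarrow> 'a \<Rightarrow> (nat \<Rightarrow> plotkin)" where
  "subbase_map S x n =
     (if x \<in> S n False then Some False else if x \<in> S n True then Some True else None)"

definition computable_dyadic_subbase :: "'a rspace \<Rightarrow> (nat \<Rightarrow> bool \<Rightarrow> 'a set) \<Rightarrow> bool" where
  "computable_dyadic_subbase X S \<longleftrightarrow>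
     dyadic_subbase X S \<and>
     computable_map (prod_rep nat_rep bit_rep) (open_rep X) (\<lambda>(n, i). Some (S n i)) \<and>
     computable_map X plotkin_seq_rep (\<lambda>x. Some (subbase_map S x)) \<and>
     inj_on (subbase_map S) (ran X) \<and>
     computable_map plotkin_seq_rep X (partial_inverse (ran X) (subbase_map S))"

definition subbase_cell :: "'a rspace \<Rightarrow> (nat \<Rightarrow> bool \<Rightarrow> 'a set) \<Rightarrow> (nat \<Rightarrow> plotkin) \<Rightarrow> 'a set" where
  "subbase_cell X S p = {x \<in> ran X. \<forall>k a. p k = Some a \<longrightarrow> x \<in> S k a}"

definition subbase_closed_cell ::
  "'a rspace \<Rightarrow> (nat \<Rightarrow> bool \<Rightarrow> 'a set) \<Rightarrow> (nat \<Rightarrow> plotkin) \<Rightarrow> 'a set" where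
  "subbase_closed_cell X S p = {x \<in> ran X. \<forall>k a. p k = Some a \<longrightarrow> x \<notin> S k (\<not> a)}"

definition proper_subbase :: "'a rspace \<Rightarrow> (nat \<Rightarrow> bool \<Rightarrow> 'a set) \<Rightarrow> bool" where
  "proper_subbase X S \<longleftrightarrow>
     (\<forall>e. rtop X closure_of subbase_cell X S (finite_seq e) =
          subbase_closed_cell X S (finite_seq e))"


section \<open>Basic facts\<close>

lemma openin_rtop:
  "openin (rtop X) U \<longleftrightarrow>
     U \<subseteq> ran X \<and> openin (top_of_set (dom X)) {p \<in> dom X. the (X p) \<in> U}"
proof -
  have "istopology (\<lambda>U. U \<subseteq> ran X \<and>
     openin (top_of_set (dom X)) {p \<in> dom X. the (X p) \<in> U})"
    unfolding istopology_def
  proof (intro conjI allI impI)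
    fix U V
    assume "U \<subseteq> ran X \<and> openin (top_of_set (dom X)) {p \<in> dom X. the (X p) \<in> U}"
      and "V \<subseteq> ran X \<and> openin (top_of_set (dom X)) {p \<in> dom X. the (X p) \<in> V}"
    moreover have "{p \<in> dom X. the (X p) \<in> U \<inter> V} =
        {p \<in> dom X. the (X p) \<in> U} \<inter> {p \<in> dom X. the (X p) \<in> V}"
      by blast
    ultimately show "U \<inter> V \<subseteq> ran X" and
      "openin (top_of_set (dom X)) {p \<in> dom X. the (X p) \<in> U \<inter> V}"
      by (auto simp only: intro: openin_Int)
  next
    fix \<U>
    assume *: "\<forall>U\<in>\<U>. U \<subseteq> ran X \<and> openin (top_of_set (dom X)) {p \<in> dom X. the (X p) \<in> U}"
    then show "\<Union>\<U> \<subseteq> ran X"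
      by blast
    have "{p \<in> dom X. the (X p) \<in> \<Union>\<U>} = \<Union>((\<lambda>U. {p \<in> dom X. the (X p) \<in> U}) ` \<U>)"
      by blast
    with * show "openin (top_of_set (dom X)) {p \<in> dom X. the (X p) \<in> \<Union>\<U>}"
      by (auto simp only: intro!: openin_Union)
  qed
  then show ?thesis
    by (simp add: rtop_def topology_inverse')
qed

lemma topspace_rtop [simp]: "topspace (rtop X) = ran X"
proof -
  have "{p \<in> dom X. the (X p) \<in> ran X} = dom X"
    by (auto simp: ran_def)
  then have "openin (rtop X) (ran X)"
    unfolding openin_rtop by simp
  moreover have "topspace (rtop X) \<subseteq> ran X"
    using iffD1[OF openin_rtop openin_topspace] by (rule conjunct1)
  ultimately show ?thesis
    using openin_subset by blast
qed

lemma associate_SomeD: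
  assumes "associate q p = Some r"
  shows "\<exists>k. q (2 * prod_encode (n, prefix_code p k))"
    and "r n = q (2 * prod_encode (n, prefix_code p
           (LEAST k. q (2 * prod_encode (n, prefix_code p k)))) + 1)"
proof -
  let ?P = "\<forall>n. \<exists>k. q (2 * prod_encode (n, prefix_code p k))"
  have P: ?P
  proof (rule ccontr)
    assume "\<not> ?P"
    with assms show False
      unfolding associate_def Let_def by (simp only: if_False option.distinct)
  qed
  then show "\<exists>k. q (2 * prod_encode (n, prefix_code p k))"
    by blast
  show "r n = q (2 * prod_encode (n, prefix_code p
           (LEAST k. q (2 * prod_encode (n, prefix_code p k)))) + 1)"
    using assms unfolding associate_def Let_def if_P[OF P] option.inject
    by (rule subst) (rule refl)
qed

lemma function_name_unique:
  assumes "function_name X Y q f" "function_name X Y q g"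
  shows "f = g"
proof (rule extensionalityI[of _ "ran X"])
  fix x assume "x \<in> ran X"
  then obtain p where "X p = Some x"
    by (auto simp: ran_def)
  with assms show "f x = g x"
    by (fastforce simp: function_name_def realizes_def)
qed (use assms in \<open>auto simp: function_name_def\<close>)

lemma function_rep_eq_Some: "function_rep X Y q = Some f \<longleftrightarrow> function_name X Y q f"
proof -
  have "(THE f. function_name X Y q f) = f" if "function_name X Y q f" for f
    by (rule the_equality[where P = "function_name X Y q", OF that])
       (rule function_name_unique[OF _ that])
  then show ?thesis
    unfolding function_rep_def by auto
qed

lemma prefix_code_bounds: "2 ^ k \<le> prefix_code p k \<and> prefix_code p k < 2 ^ Suc k"
  by (induction k) auto

lemma prefix_code_length:
  assumes "prefix_code p k = prefix_code p' k'"
  shows "k = k'"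
proof (rule ccontr)
  have *: "prefix_code r m < prefix_code s n" if "m < n" for r s :: cantor and m n
  proof -
    have "prefix_code r m < 2 ^ Suc m"
      using prefix_code_bounds by blast
    also have "\<dots> \<le> 2 ^ n"
      using that by (intro power_increasing) auto
    also have "\<dots> \<le> prefix_code s n"
      using prefix_code_bounds by blast
    finally show ?thesis .
  qed
  assume "k \<noteq> k'"
  then show False
    using *[of k k' p p'] *[of k' k p' p] assms by linarith
qed

lemma prefix_code_eq_iff: "prefix_code p k = prefix_code p' k \<longleftrightarrow> (\<forall>i<k. p i = p' i)"
proof (induction k)
  case (Suc k)
  have "2 * a + of_bool x = 2 * b + of_bool y \<longleftrightarrow> a = b \<and> x = y" for a b :: nat and x y
    by (cases x; cases y; simp; presburger)
  then show ?case
    by (simp add: Suc less_Suc_eq) blast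
qed auto

lemma open_cylinder: "open {p' :: cantor. \<forall>i<k. p' i = p i}"
proof -
  have "{p'. \<forall>i<k. p' i = p i} = (\<Inter>i\<in>{..<k}. (\<lambda>p'. p' i) -` {p i})"
    by auto
  also have "open \<dots>"
    by (intro open_INT finite_lessThan ballI open_vimage open_discrete
        continuous_on_product_coordinates)
  finally show ?thesis .
qed

lemma open_contains_cylinder:
  fixes W :: "cantor set"
  assumes "open W" "p \<in> W"
  obtains k where "{p'. \<forall>i<k. p' i = p i} \<subseteq> W"
proof -
  have "openin (product_topology (\<lambda>i. euclidean) UNIV) W"
    using assms(1) by (simp add: open_fun_def)
  from product_topology_open_contains_basis[OF this assms(2)]
  obtain B where B: "p \<in> (\<Pi>\<^sub>E i\<in>UNIV. B i)" "finite {i. B i \<noteq> topspace euclidean}"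
      "(\<Pi>\<^sub>E i\<in>UNIV. B i) \<subseteq> W"
    by blast
  obtain k where k: "{i. B i \<noteq> UNIV} \<subseteq> {..<k}"
    using finite_nat_iff_bounded B(2) by auto
  have "{p'. \<forall>i<k. p' i = p i} \<subseteq> (\<Pi>\<^sub>E i\<in>UNIV. B i)"
  proof (clarsimp simp: PiE_def)
    fix p' i assume "\<forall>i<k. p' i = p i"
    then show "p' i \<in> B i"
      using k B(1) by (cases "i < k") (auto simp: PiE_def Pi_def)
  qed
  then show thesis
    by (rule that[OF subset_trans[OF _ B(3)]])
qed

lemma open_rep_eq_Some:
  "open_rep X q = Some U \<longleftrightarrow>
     U \<subseteq> ran X \<and> function_name X sierpinski q (\<lambda>x\<in>ran X. x \<in> U)"
proof
  assume "open_rep X q = Some U"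
  then obtain f where f: "function_name X sierpinski q f" "U = {x \<in> ran X. f x}"
    by (auto simp: open_rep_def function_rep_eq_Some)
  then have "(\<lambda>x\<in>ran X. x \<in> U) = f"
    by (auto simp: function_name_def extensional_def restrict_def)
  with f show "U \<subseteq> ran X \<and> function_name X sierpinski q (\<lambda>x\<in>ran X. x \<in> U)"
    by auto
next
  assume *: "U \<subseteq> ran X \<and> function_name X sierpinski q (\<lambda>x\<in>ran X. x \<in> U)"
  then have "function_rep X sierpinski q = Some (\<lambda>x\<in>ran X. x \<in> U)"
    by (simp add: function_rep_eq_Some)
  with * show "open_rep X q = Some U"
    by (auto simp: open_rep_def)
qed

theorem ran_open_rep: "U \<in> ran (open_rep X) \<longleftrightarrow> openin (rtop X) U"
proof
  assume "U \<in> ran (open_rep X)"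
  then obtain q where U: "U \<subseteq> ran X"
    and q: "realizes (associate q) X sierpinski (\<lambda>x. Some (x \<in> ran X \<and> x \<in> U))"
    by (fastforce simp: ran_def[of "open_rep X"] open_rep_eq_Some function_name_def
        realizes_def ranI)
  have key: "\<exists>r. associate q p = Some r \<and> ((\<exists>n. r n) \<longleftrightarrow> x \<in> U)" if "X p = Some x" for p x
    using q that by (fastforce simp: realizes_def sierpinski_def ranI)
  have "\<exists>T. open T \<and> p \<in> T \<and> T \<inter> dom X \<subseteq> {p \<in> dom X. the (X p) \<in> U}"
    if p: "p \<in> dom X" "the (X p) \<in> U" for p
  proof -
    obtain x where "X p = Some x"
      using p by blast
    with key[OF this] p obtain r n where r: "associate q p = Some r" "r n"
      by auto
    define c where "c = (\<lambda>p k. prod_encode (n, prefix_code p k))"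
    define K where "K = (LEAST k. q (2 * c p k))"
    have K: "q (2 * c p K)" "q (2 * c p K + 1)"
      using LeastI_ex[OF associate_SomeD(1)[OF r(1), of n]] r(2)
      unfolding K_def c_def associate_SomeD(2)[OF r(1), of n] by simp_all
    have below: "\<not> q (2 * c p k)" if "k < K" for k
      using that not_less_Least unfolding K_def by blast
    have "the (X p') \<in> U" if p': "p' \<in> dom X" "\<forall>i<K. p' i = p i" for p'
    proof -
      have eq: "c p' k = c p k" if "k \<le> K" for k
        using p'(2) that by (auto simp: c_def prefix_code_eq_iff)
      have "(LEAST k. q (2 * c p' k)) = K"
      proof (rule Least_equality)
        show "q (2 * c p' K)"
          using K eq by simp
        show "K \<le> k" if "q (2 * c p' k)" for k
          using that below[of k] eq[of k] by (metis linorder_not_le less_imp_le)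
      qed
      moreover obtain x' where x': "X p' = Some x'"
        using p'(1) by blast
      then obtain r' where r': "associate q p' = Some r'" "(\<exists>n. r' n) \<longleftrightarrow> the (X p') \<in> U"
        using key[OF x'] by auto
      ultimately have "r' n"
        using K(2) eq[of K] unfolding associate_SomeD(2)[OF r'(1)] c_def by simp
      with r' show ?thesis
        by blast
    qed
    then show ?thesis
      using open_cylinder[of K p]
      by (intro exI[of _ "{p'. \<forall>i<K. p' i = p i}"]) auto
  qed
  then have "openin (top_of_set (dom X)) {p \<in> dom X. the (X p) \<in> U}"
    unfolding openin_subopen[of _ "{p \<in> dom X. the (X p) \<in> U}"] openin_open
    by (smt (verit) Int_commute Int_iff mem_Collect_eq)
  with U show "openin (rtop X) U"
    by (simp add: openin_rtop)
next
  assume "openin (rtop X) U"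
  then obtain W where U: "U \<subseteq> ran X" and W: "open W"
    "{p \<in> dom X. the (X p) \<in> U} = dom X \<inter> W"
    by (auto simp: openin_rtop openin_open)
  define q :: cantor where "q = (\<lambda>m. case prod_decode (m div 2) of (n, w) \<Rightarrow>
     if even m then \<exists>p. w = prefix_code p n else \<forall>p. w = prefix_code p n \<longrightarrow> p \<in> W)"
  have halt: "q (2 * prod_encode (n, prefix_code p k)) \<longleftrightarrow> k = n" for n p k
    by (auto simp: q_def dest: prefix_code_length)
  have assoc: "associate q p = Some (\<lambda>n. \<forall>p'. (\<forall>i<n. p i = p' i) \<longrightarrow> p' \<in> W)" for p
  proof -
    have "(LEAST k. k = n) = n" for n :: nat
      by (rule Least_equality) auto
    then show ?thesis
      by (simp add: associate_def halt Let_def) (simp add: q_def prefix_code_eq_iff)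
  qed
  have "(\<exists>n. \<forall>p'. (\<forall>i<n. p i = p' i) \<longrightarrow> p' \<in> W) \<longleftrightarrow> p \<in> W" for p
  proof
    assume "p \<in> W"
    from open_contains_cylinder[OF W(1) this] obtain k where
      "{p'. \<forall>i<k. p' i = p i} \<subseteq> W" .
    then show "\<exists>n. \<forall>p'. (\<forall>i<n. p i = p' i) \<longrightarrow> p' \<in> W"
      by (intro exI[of _ k]) auto
  qed auto
  moreover have "p \<in> W \<longleftrightarrow> x \<in> U" if "X p = Some x" for p x
    using W(2) that by force
  ultimately have "function_name X sierpinski q (\<lambda>x\<in>ran X. x \<in> U)"
    by (simp add: function_name_def realizes_def assoc sierpinski_def ranI)
  with U have "open_rep X q = Some U"
    by (simp add: open_rep_eq_Some)
  then show "U \<in> ran (open_rep X)"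
    by (auto simp: ran_def)
qed

lemma compact_name_unique:
  assumes "compact_name X q A" "compact_name X q B"
  shows "A = B"
proof -
  have "{U. openin (rtop X) U \<and> A \<subseteq> U} = {U. openin (rtop X) U \<and> B \<subseteq> U}"
    using assms by (simp add: compact_name_def ran_open_rep)
  then show ?thesis
    using assms by (metis compact_name_def)
qed

lemma compact_rep_eq_Some: "compact_rep X q = Some A \<longleftrightarrow> compact_name X q A"
proof -
  have "(THE A. compact_name X q A) = A" if "compact_name X q A" for A
    using that by (rule the_equality) (rule compact_name_unique[OF _ that])
  then show ?thesis
    unfolding compact_rep_def by auto
qed

end

theory Submission
  imports Defs
begin

text \<open>
  Enumerate the basic open cells \<open>S(e\<^sub>m)\<close>. In the new representation \<open>\<delta>\<close>, the even bits of \<open>q\<close> form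
  an \<open>X\<close>-name of \<open>x\<close>, and a zero at \<open>2m + 1\<close> asserts that \<open>x \<notin> S(e\<^sub>m)\<close>; a one asserts nothing, so
  \<open>\<delta>\<close> is equivalent to the given representation. Dually, \<open>\<psi>\<close> is defined on sequences that are
  \<open>\<bottom>\<close> at even positions, and \<open>\<psi>(p)\<close> is the complement of the union of the cells \<open>S(e\<^sub>m)\<close> with
  \<open>p(2m + 1) = 0\<close>. Then \<open>p\<close> has a total refinement naming \<open>x\<close> iff \<open>x \<in> \<psi>(p)\<close>.

  A \<open>\<psi>\<close>-name of \<open>A\<close> makes \<open>x \<notin> A\<close> semidecidable. Over a computably compact space this suffices to
  semidecide \<open>A \<subseteq> U\<close>, which says that every point lies in \<open>U\<close> or outside \<open>A\<close>. Conversely, given a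
  compact set \<open>A\<close>, put \<open>p(2m + 1) = 0\<close> as soon as \<open>A\<close> is found to lie in the union of the sets
  \<open>S\<^bsub>k,1-e(k)\<^esub>\<close>, \<open>e = e\<^sub>m\<close>. As \<open>S\<close> is proper, this union is the exterior of the cell, and in a
  Hausdorff space the cells whose closure misses \<open>A\<close> cover the complement of \<open>A\<close>.
\<close>

section \<open>Total recursive functions relative to an oracle\<close>

abbreviation lproj :: "nat \<Rightarrow> nat" where
  "lproj c \<equiv> fst (prod_decode c)"

abbreviation rproj :: "nat \<Rightarrow> nat" where
  "rproj c \<equiv> snd (prod_decode c)"

definition total_recursive :: "(cantor \<Rightarrow> nat \<Rightarrow> nat) \<Rightarrow> bool" where
  "total_recursive f \<longleftrightarrow> partial_recursive (\<lambda>p n. Some (f p n))"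

definition recursive_pred :: "(cantor \<Rightarrow> nat \<Rightarrow> bool) \<Rightarrow> bool" where
  "recursive_pred P \<longleftrightarrow> total_recursive (\<lambda>p n. of_bool (P p n))"

abbreviation recursive_pred2 :: "(cantor \<Rightarrow> nat \<Rightarrow> nat \<Rightarrow> bool) \<Rightarrow> bool" where
  "recursive_pred2 P \<equiv> recursive_pred (\<lambda>p c. P p (lproj c) (rproj c))"

abbreviation recursive_pred3 :: "(cantor \<Rightarrow> nat \<Rightarrow> nat \<Rightarrow> nat \<Rightarrow> bool) \<Rightarrow> bool" where
  "recursive_pred3 P \<equiv> recursive_pred (\<lambda>p c. P p (lproj c) (lproj (rproj c)) (rproj (rproj c)))"

named_theorems recursive_intros

lemma total_recursive_Suc_id: "total_recursive (\<lambda>p. Suc)"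
  unfolding total_recursive_def by (rule pr_succ)

lemma total_recursive_lproj_id: "total_recursive (\<lambda>p. lproj)"
  unfolding total_recursive_def by (rule pr_fst)

lemma total_recursive_rproj_id: "total_recursive (\<lambda>p. rproj)"
  unfolding total_recursive_def by (rule pr_snd)

lemma total_recursive_comp:
  assumes "total_recursive f" "total_recursive g"
  shows "total_recursive (\<lambda>p n. f p (g p n))"
  using pr_comp[OF assms[unfolded total_recursive_def]] by (simp add: total_recursive_def)

lemma total_recursive_pair [recursive_intros]:
  assumes "total_recursive f" "total_recursive g"
  shows "total_recursive (\<lambda>p n. prod_encode (f p n, g p n))"
  using pr_pair[OF assms[unfolded total_recursive_def]] by (simp add: total_recursive_def)

lemma total_recursive_id [recursive_intros]: "total_recursive (\<lambda>p n. n)"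
  using total_recursive_pair[OF total_recursive_lproj_id total_recursive_rproj_id] by simp

lemma total_recursive_const [recursive_intros]: "total_recursive (\<lambda>p n. k)"
proof (induction k)
  case 0
  show ?case
    unfolding total_recursive_def by (rule pr_zero)
next
  case (Suc k)
  from total_recursive_comp[OF total_recursive_Suc_id this] show ?case .
qed

lemmas total_recursive_Suc [recursive_intros] = total_recursive_comp[OF total_recursive_Suc_id]
lemmas total_recursive_lproj [recursive_intros] = total_recursive_comp[OF total_recursive_lproj_id]
lemmas total_recursive_rproj [recursive_intros] = total_recursive_comp[OF total_recursive_rproj_id]

lemma total_recursive_rec_nat [recursive_intros]:
  assumes "total_recursive f"
    and "total_recursive (\<lambda>p c. g p (lproj c) (lproj (rproj c)) (rproj (rproj c)))"
    and "total_recursive h"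
  shows "total_recursive (\<lambda>p n. rec_nat (f p n) (g p n) (h p n))"
proof -
  have "rec_nat (Some (f p a))
      (\<lambda>k r. Option.bind r (\<lambda>v. Some (g p (lproj (prod_encode (a, prod_encode (k, v))))
        (lproj (rproj (prod_encode (a, prod_encode (k, v)))))
        (rproj (rproj (prod_encode (a, prod_encode (k, v)))))))) n =
     Some (rec_nat (f p a) (g p a) n)" for p a n
    by (induction n) simp_all
  with pr_rec[OF assms(1,2)[unfolded total_recursive_def]]
  have "total_recursive (\<lambda>p c. rec_nat (f p (lproj c)) (g p (lproj c)) (rproj c))"
    by (simp add: total_recursive_def case_prod_unfold)
  from total_recursive_comp[OF this total_recursive_pair[OF total_recursive_id assms(3)]]
  show ?thesis
    by simp
qed

lemma total_recursive_add [recursive_intros]: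
  assumes "total_recursive f" "total_recursive g"
  shows "total_recursive (\<lambda>p n. f p n + g p n)"
proof -
  have "a + b = rec_nat a (\<lambda>_. Suc) b" for a b
    by (induction b) auto
  then show ?thesis
    by (simp only:) (intro recursive_intros assms)
qed

lemma total_recursive_mult [recursive_intros]:
  assumes "total_recursive f" "total_recursive g"
  shows "total_recursive (\<lambda>p n. f p n * g p n)"
proof -
  have "a * b = rec_nat 0 (\<lambda>_ v. v + a) b" for a b
    by (induction b) auto
  then show ?thesis
    by (simp only:) (intro recursive_intros total_recursive_comp[OF assms(1)] assms)
qed

lemma total_recursive_pred [recursive_intros]:
  assumes "total_recursive f"
  shows "total_recursive (\<lambda>p n. f p n - 1)"
proof -
  have "a - 1 = rec_nat 0 (\<lambda>k _. k) a" for a :: nat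
    by (cases a) auto
  then show ?thesis
    by (simp only:) (intro recursive_intros assms)
qed

lemma total_recursive_diff [recursive_intros]:
  assumes "total_recursive f" "total_recursive g"
  shows "total_recursive (\<lambda>p n. f p n - g p n)"
proof -
  have "a - b = rec_nat a (\<lambda>_ v. v - 1) b" for a b :: nat
    by (induction b) auto
  then have "(\<lambda>p n. f p n - g p n) = (\<lambda>p n. rec_nat (f p n) (\<lambda>_ v. v - 1) (g p n))"
    by (intro ext)
  then show ?thesis
    by (simp only:) (intro recursive_intros assms)
qed

lemma total_recursive_of_bool [recursive_intros]:
  "recursive_pred P \<Longrightarrow> total_recursive (\<lambda>p n. of_bool (P p n))"
  by (simp add: recursive_pred_def)

lemma recursive_pred_comp:
  assumes "recursive_pred P" "total_recursive g"
  shows "recursive_pred (\<lambda>p n. P p (g p n))"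
  using total_recursive_comp[OF assms[unfolded recursive_pred_def]]
  by (simp add: recursive_pred_def)

lemma recursive_pred_comp2:
  assumes "recursive_pred2 P" "total_recursive f" "total_recursive g"
  shows "recursive_pred (\<lambda>p n. P p (f p n) (g p n))"
  using recursive_pred_comp[OF assms(1) total_recursive_pair[OF assms(2,3)]] by simp

lemma recursive_pred_comp3:
  assumes "recursive_pred3 P"
    and "total_recursive f" "total_recursive g" "total_recursive h"
  shows "recursive_pred (\<lambda>p n. P p (f p n) (g p n) (h p n))"
  using recursive_pred_comp[OF assms(1)
      total_recursive_pair[OF assms(2) total_recursive_pair[OF assms(3,4)]]] by simp

lemma recursive_pred_oracle [recursive_intros]:
  assumes "total_recursive g"
  shows "recursive_pred (\<lambda>p n. p (g p n))"
proof (rule recursive_pred_comp[OF _ assms])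
  show "recursive_pred (\<lambda>p. p)"
    unfolding recursive_pred_def total_recursive_def by (rule pr_oracle)
qed

lemma recursive_pred_const [recursive_intros]: "recursive_pred (\<lambda>p n. b)"
  unfolding recursive_pred_def by (rule total_recursive_const)

lemma recursive_pred_not [recursive_intros]:
  assumes "recursive_pred P"
  shows "recursive_pred (\<lambda>p n. \<not> P p n)"
proof -
  have "of_bool (\<not> b) = 1 - (of_bool b :: nat)" for b
    by simp
  then show ?thesis
    unfolding recursive_pred_def by (simp only:) (intro recursive_intros assms)
qed

lemma recursive_pred_conj [recursive_intros]:
  assumes "recursive_pred P" "recursive_pred Q"
  shows "recursive_pred (\<lambda>p n. P p n \<and> Q p n)"
  unfolding recursive_pred_def of_bool_conj by (intro recursive_intros assms)

lemma recursive_pred_disj [recursive_intros]: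
  assumes "recursive_pred P" "recursive_pred Q"
  shows "recursive_pred (\<lambda>p n. P p n \<or> Q p n)"
proof -
  have "recursive_pred (\<lambda>p n. \<not> (\<not> P p n \<and> \<not> Q p n))"
    by (intro recursive_intros assms)
  then show ?thesis
    by simp
qed

lemma recursive_pred_imp [recursive_intros]:
  assumes "recursive_pred P" "recursive_pred Q"
  shows "recursive_pred (\<lambda>p n. P p n \<longrightarrow> Q p n)"
  unfolding imp_conv_disj by (intro recursive_intros assms)

lemma recursive_pred_iff [recursive_intros]:
  assumes "recursive_pred P" "recursive_pred Q"
  shows "recursive_pred (\<lambda>p n. P p n = Q p n)"
  unfolding iff_conv_conj_imp by (intro recursive_intros assms)

lemma recursive_pred_if [recursive_intros]:
  assumes "recursive_pred P" "recursive_pred Q" "recursive_pred R"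
  shows "recursive_pred (\<lambda>p n. if P p n then Q p n else R p n)"
  unfolding if_bool_eq_conj by (intro recursive_intros assms)

lemma recursive_pred_le [recursive_intros]:
  assumes "total_recursive f" "total_recursive g"
  shows "recursive_pred (\<lambda>p n. f p n \<le> g p n)"
proof -
  have "of_bool (a \<le> b) = 1 - (a - b)" for a b :: nat
    by auto
  then show ?thesis
    unfolding recursive_pred_def by (simp only:) (intro recursive_intros assms)
qed

lemma recursive_pred_less [recursive_intros]:
  assumes "total_recursive f" "total_recursive g"
  shows "recursive_pred (\<lambda>p n. f p n < g p n)"
  unfolding Suc_le_eq[symmetric] by (intro recursive_intros assms)

lemma recursive_pred_eq [recursive_intros]:
  assumes "total_recursive f" "total_recursive g"
  shows "recursive_pred (\<lambda>p n. f p n = g p n)"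
  unfolding eq_iff by (intro recursive_intros assms)

lemma recursive_pred_all_less [recursive_intros]:
  assumes "recursive_pred2 P" "total_recursive b"
  shows "recursive_pred (\<lambda>p n. \<forall>k<b p n. P p n k)"
proof -
  have "(of_bool (\<forall>k<b. Q k) :: nat) = rec_nat 1 (\<lambda>k v. v * of_bool (Q k)) b" for b and Q
    by (induction b)
       (simp_all add: All_less_Suc of_bool_conj del: of_bool_eq_iff flip: of_bool_eq_1_iff)
  moreover have "recursive_pred (\<lambda>p c. P p (lproj c) (lproj (rproj c)))"
    by (intro recursive_pred_comp2[OF assms(1)] recursive_intros)
  ultimately show ?thesis
    unfolding recursive_pred_def
    by (simp only:) (intro recursive_intros assms; simp add: recursive_pred_def)
qed

lemma recursive_pred_ex_less [recursive_intros]: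
  assumes "recursive_pred2 P" "total_recursive b"
  shows "recursive_pred (\<lambda>p n. \<exists>k<b p n. P p n k)"
proof -
  have "recursive_pred (\<lambda>p n. \<not> (\<forall>k<b p n. \<not> P p n k))"
    by (intro recursive_intros assms)
  then show ?thesis
    by simp
qed

lemma recursive_pred_odd [recursive_intros]:
  assumes "total_recursive f"
  shows "recursive_pred (\<lambda>p n. odd (f p n))"
proof -
  have "(of_bool (odd a) :: nat) = rec_nat 0 (\<lambda>_ v. 1 - v) a" for a :: nat
    by (induction a) auto
  then show ?thesis
    unfolding recursive_pred_def by (simp only:) (intro recursive_intros assms)
qed

lemma recursive_pred_even [recursive_intros]:
  assumes "total_recursive f"
  shows "recursive_pred (\<lambda>p n. even (f p n))"
  using recursive_pred_not[OF recursive_pred_odd[OF assms]] by simp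

lemma total_recursive_div2 [recursive_intros]:
  assumes "total_recursive f"
  shows "total_recursive (\<lambda>p n. f p n div 2)"
proof -
  have "Suc a div 2 = a div 2 + of_bool (odd a)" for a :: nat
    by (cases "odd a") (auto elim!: oddE evenE)
  then have "a div 2 = rec_nat 0 (\<lambda>k v. v + of_bool (odd k)) a" for a :: nat
    by (induction a) simp_all
  then show ?thesis
    by (simp only:) (intro recursive_intros assms)
qed

lemma total_recursive_div_power2 [recursive_intros]:
  assumes "total_recursive f" "total_recursive g"
  shows "total_recursive (\<lambda>p n. f p n div 2 ^ g p n)"
proof -
  have "a div 2 ^ b = rec_nat a (\<lambda>_ v. v div 2) b" for a b :: nat
    by (induction b) (auto simp: div_mult2_eq power_Suc2 simp del: power_Suc)
  then show ?thesis
    by (simp only:) (intro recursive_intros assms)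
qed

lemma total_recursive_prefix_code [recursive_intros]:
  assumes "recursive_pred2 q" "total_recursive h"
  shows "total_recursive (\<lambda>p n. prefix_code (q p n) (h p n))"
proof -
  have "prefix_code r k = rec_nat 1 (\<lambda>k v. 2 * v + of_bool (r k)) k" for r k
    by (induction k) auto
  moreover have "recursive_pred (\<lambda>p c. q p (lproj c) (lproj (rproj c)))"
    by (intro recursive_pred_comp2[OF assms(1)] recursive_intros)
  ultimately show ?thesis
    by (simp only:) (intro recursive_intros assms)
qed

lemma computable_map_recursive:
  assumes "recursive_pred F" "\<And>p x y. X p = Some x \<Longrightarrow> f x = Some y \<Longrightarrow> Y (F p) = Some y"
  shows "computable_map X Y f"
proof -
  have "computable (\<lambda>p. Some (F p))"
    using assms(1) unfolding recursive_pred_def total_recursive_def computable_def by auto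
  moreover have "realizes (\<lambda>p. Some (F p)) X Y f"
    using assms(2) by (simp add: realizes_def)
  ultimately show ?thesis
    unfolding computable_map_def by blast
qed

text \<open>The \<open>i\<close>-th entry of the finite sequence coded by \<open>\<langle>s\<^sub>0, \<langle>s\<^sub>1, \<langle>s\<^sub>2, \<dots>\<rangle>\<rangle>\<rangle>\<close>.\<close>

definition nth_code :: "nat \<Rightarrow> nat \<Rightarrow> nat" where
  "nth_code c i = lproj ((rproj ^^ i) c)"

lemma nth_code_simps [simp]:
  "nth_code c 0 = lproj c"
  "nth_code c (Suc i) = nth_code (rproj c) i"
  by (simp_all add: nth_code_def funpow_Suc_right del: funpow.simps)

lemma ex_nth_code: "\<exists>c. \<forall>i\<le>n. nth_code c i = s i"
proof (induction n arbitrary: s)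
  case 0
  show ?case
    by (rule exI[of _ "prod_encode (s 0, 0)"]) simp
next
  case (Suc n)
  from Suc[of "\<lambda>i. s (Suc i)"] obtain c where "\<forall>i\<le>n. nth_code c i = s (Suc i)" ..
  then have "nth_code (prod_encode (s 0, c)) i = s i" if "i \<le> Suc n" for i
    using that by (cases i) simp_all
  then show ?case
    by blast
qed

lemma total_recursive_nth_code [recursive_intros]:
  assumes "total_recursive f" "total_recursive g"
  shows "total_recursive (\<lambda>p n. nth_code (f p n) (g p n))"
proof -
  have "(rproj ^^ i) c = rec_nat c (\<lambda>_. rproj) i" for c i
    by (induction i) simp_all
  then show ?thesis
    unfolding nth_code_def by (simp only:) (intro recursive_intros assms)
qed


section \<open>Semirecursive relations\<close>

text \<open>\<open>D\<close> has no access to the oracle: it only sees the length and the code of a prefix.\<close>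

definition semirecursive :: "(cantor \<Rightarrow> nat \<Rightarrow> bool) \<Rightarrow> bool" where
  "semirecursive R \<longleftrightarrow> (\<exists>D. recursive_pred3 (\<lambda>p. D) \<and>
     (\<forall>p n. R p n \<longleftrightarrow> (\<exists>k. D n k (prefix_code p k))))"

lemma prefix_code_div_power2:
  assumes "i \<le> k"
  shows "prefix_code p k div 2 ^ i = prefix_code p (k - i)"
  using assms
proof (induction i)
  case (Suc i)
  then have "prefix_code p k div 2 ^ Suc i = prefix_code p (Suc (k - Suc i)) div 2"
    by (simp add: div_mult2_eq power_Suc2 Suc_diff_Suc del: power_Suc prefix_code.simps)
  then show ?case
    by simp
qed simp

definition code_bit :: "nat \<Rightarrow> nat \<Rightarrow> nat \<Rightarrow> bool" where
  "code_bit k w i \<longleftrightarrow> odd (w div 2 ^ (k - Suc i))"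

lemma code_bit_prefix_code:
  assumes "i < k"
  shows "code_bit k (prefix_code p k) i = p i"
proof -
  have "k - (k - Suc i) = Suc i"
    using assms by simp
  then have "prefix_code p k div 2 ^ (k - Suc i) = prefix_code p (Suc i)"
    using prefix_code_div_power2[of "k - Suc i" k p] by simp
  then show ?thesis
    by (simp add: code_bit_def)
qed

lemma recursive_pred_code_bit [recursive_intros]:
  assumes "total_recursive f" "total_recursive g" "total_recursive h"
  shows "recursive_pred (\<lambda>p n. code_bit (f p n) (g p n) (h p n))"
  unfolding code_bit_def by (intro recursive_intros assms)

lemma semirecursiveI:
  assumes "recursive_pred3 (\<lambda>p. D)"
    and "\<And>p n k. D n k (prefix_code p k) \<Longrightarrow> R p n"
    and "\<And>p n. R p n \<Longrightarrow> \<forall>\<^sub>F k in sequentially. D n k (prefix_code p k)"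
  shows "semirecursive R"
  unfolding semirecursive_def
proof (intro exI[of _ D] conjI allI iffI assms(1))
  fix p n assume "R p n"
  from eventually_happens'[OF _ assms(3)[OF this]] show "\<exists>k. D n k (prefix_code p k)"
    by simp
qed (use assms(2) in blast)

lemma semirecursiveE:
  assumes "semirecursive R"
  obtains D where "recursive_pred3 (\<lambda>p. D)"
    and "\<And>p n k. D n k (prefix_code p k) \<Longrightarrow> R p n"
    and "\<And>p n. R p n \<Longrightarrow> \<forall>\<^sub>F k in sequentially. D n k (prefix_code p k)"
proof -
  obtain D where D: "recursive_pred3 (\<lambda>p. D)"
      "\<And>p n. R p n \<longleftrightarrow> (\<exists>k. D n k (prefix_code p k))"
    using assms by (auto simp: semirecursive_def)
  define D' where "D' n k w \<longleftrightarrow> (\<exists>j<Suc k. D n j (w div 2 ^ (k - j)))" for n k w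
  have D'_iff: "D' n k (prefix_code p k) \<longleftrightarrow> (\<exists>j\<le>k. D n j (prefix_code p j))" for p n k
    unfolding D'_def by (auto simp: prefix_code_div_power2 less_Suc_eq_le)
  show thesis
  proof (rule that)
    show "recursive_pred3 (\<lambda>p. D')"
      unfolding D'_def by (intro recursive_intros recursive_pred_comp3[OF D(1)])
    show "R p n" if "D' n k (prefix_code p k)" for p n k
      using that D(2) D'_iff by blast
    show "\<forall>\<^sub>F k in sequentially. D' n k (prefix_code p k)" if "R p n" for p n
      using that unfolding D(2) D'_iff eventually_sequentially by blast
  qed
qed

named_theorems semirecursive_intros

lemma semirecursive_oracle_free:
  assumes "recursive_pred (\<lambda>p. P)"
  shows "semirecursive (\<lambda>p. P)"
proof (rule semirecursiveI)
  show "recursive_pred3 (\<lambda>p n k w. P n)"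
    by (intro recursive_pred_comp[OF assms] recursive_intros)
qed simp_all

lemma semirecursive_comp:
  assumes "semirecursive R" "total_recursive (\<lambda>p. g)"
  shows "semirecursive (\<lambda>p n. R p (g n))"
proof -
  obtain D where D: "recursive_pred3 (\<lambda>p. D)"
      "\<And>p n k. D n k (prefix_code p k) \<Longrightarrow> R p n"
      "\<And>p n. R p n \<Longrightarrow> \<forall>\<^sub>F k in sequentially. D n k (prefix_code p k)"
    using assms(1) by (rule semirecursiveE) blast
  show ?thesis
  proof (rule semirecursiveI)
    show "recursive_pred3 (\<lambda>p n. D (g n))"
      by (intro recursive_pred_comp3[OF D(1)] recursive_intros total_recursive_comp[OF assms(2)])
  qed (fact D(2), fact D(3))
qed

lemma semirecursive_conj [semirecursive_intros]:
  assumes "semirecursive Q" "semirecursive R"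
  shows "semirecursive (\<lambda>p n. Q p n \<and> R p n)"
proof -
  obtain D where D: "recursive_pred3 (\<lambda>p. D)"
      "\<And>p n k. D n k (prefix_code p k) \<Longrightarrow> Q p n"
      "\<And>p n. Q p n \<Longrightarrow> \<forall>\<^sub>F k in sequentially. D n k (prefix_code p k)"
    using assms(1) by (rule semirecursiveE) blast
  obtain E where E: "recursive_pred3 (\<lambda>p. E)"
      "\<And>p n k. E n k (prefix_code p k) \<Longrightarrow> R p n"
      "\<And>p n. R p n \<Longrightarrow> \<forall>\<^sub>F k in sequentially. E n k (prefix_code p k)"
    using assms(2) by (rule semirecursiveE) blast
  show ?thesis
  proof (rule semirecursiveI)
    show "recursive_pred3 (\<lambda>p n k w. D n k w \<and> E n k w)"
      by (intro recursive_pred_conj D(1) E(1))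
    show "Q p n \<and> R p n" if "D n k (prefix_code p k) \<and> E n k (prefix_code p k)" for p n k
      using that D(2) E(2) by blast
    show "\<forall>\<^sub>F k in sequentially. D n k (prefix_code p k) \<and> E n k (prefix_code p k)"
      if "Q p n \<and> R p n" for p n
      using that by (intro eventually_conj D(3) E(3)) simp_all
  qed
qed

lemma semirecursive_disj [semirecursive_intros]:
  assumes "semirecursive Q" "semirecursive R"
  shows "semirecursive (\<lambda>p n. Q p n \<or> R p n)"
proof -
  obtain D where D: "recursive_pred3 (\<lambda>p. D)"
      "\<And>p n. Q p n \<longleftrightarrow> (\<exists>k. D n k (prefix_code p k))"
    using assms(1) by (auto simp: semirecursive_def)
  obtain E where E: "recursive_pred3 (\<lambda>p. E)"
      "\<And>p n. R p n \<longleftrightarrow> (\<exists>k. E n k (prefix_code p k))"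
    using assms(2) by (auto simp: semirecursive_def)
  have "recursive_pred3 (\<lambda>p n k w. D n k w \<or> E n k w)"
    by (intro recursive_pred_disj D(1) E(1))
  then show ?thesis
    unfolding semirecursive_def D(2) E(2) ex_disj_distrib[symmetric]
    by (intro exI[of _ "\<lambda>n k w. D n k w \<or> E n k w"] conjI) simp_all
qed

lemma semirecursive_ex [semirecursive_intros]:
  assumes "semirecursive (\<lambda>p c. R p (lproj c) (rproj c))"
  shows "semirecursive (\<lambda>p n. \<exists>m. R p n m)"
proof -
  obtain D where D: "recursive_pred3 (\<lambda>p. D)"
      "\<And>p c k. D c k (prefix_code p k) \<Longrightarrow> R p (lproj c) (rproj c)"
      "\<And>p c. R p (lproj c) (rproj c) \<Longrightarrow> \<forall>\<^sub>F k in sequentially. D c k (prefix_code p k)"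
    using assms by (rule semirecursiveE) blast
  show ?thesis
  proof (rule semirecursiveI)
    show "recursive_pred3 (\<lambda>p n k w. \<exists>m<k. D (prod_encode (n, m)) k w)"
      by (intro recursive_intros recursive_pred_comp3[OF D(1)])
  next
    fix p n k assume "\<exists>m<k. D (prod_encode (n, m)) k (prefix_code p k)"
    then obtain m where "D (prod_encode (n, m)) k (prefix_code p k)"
      by blast
    from D(2)[OF this] show "\<exists>m. R p n m"
      by auto
  next
    fix p n assume "\<exists>m. R p n m"
    then obtain m where "R p n m" ..
    then have "\<forall>\<^sub>F k in sequentially. D (prod_encode (n, m)) k (prefix_code p k)"
      by (intro D(3)) simp
    with eventually_gt_at_top[of m]
    show "\<forall>\<^sub>F k in sequentially. \<exists>m<k. D (prod_encode (n, m)) k (prefix_code p k)"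
      by eventually_elim blast
  qed
qed

lemma semirecursive_all_less [semirecursive_intros]:
  assumes "semirecursive (\<lambda>p c. R p (lproj c) (rproj c))" "total_recursive (\<lambda>p. b)"
  shows "semirecursive (\<lambda>p n. \<forall>m<b n. R p n m)"
proof -
  obtain D where D: "recursive_pred3 (\<lambda>p. D)"
      "\<And>p c k. D c k (prefix_code p k) \<Longrightarrow> R p (lproj c) (rproj c)"
      "\<And>p c. R p (lproj c) (rproj c) \<Longrightarrow> \<forall>\<^sub>F k in sequentially. D c k (prefix_code p k)"
    using assms(1) by (rule semirecursiveE) blast
  show ?thesis
  proof (rule semirecursiveI)
    show "recursive_pred3 (\<lambda>p n k w. \<forall>m<b n. D (prod_encode (n, m)) k w)"
      by (intro recursive_intros recursive_pred_comp3[OF D(1)] total_recursive_comp[OF assms(2)])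
    show "\<forall>m<b n. R p n m" if "\<forall>m<b n. D (prod_encode (n, m)) k (prefix_code p k)" for p n k
      using that D(2)[of "prod_encode (n, m)" k p for m] by simp
  next
    fix p n assume "\<forall>m<b n. R p n m"
    then have "\<forall>\<^sub>F k in sequentially. \<forall>m\<in>{..<b n}. D (prod_encode (n, m)) k (prefix_code p k)"
      by (intro eventually_ball_finite finite_lessThan ballI D(3)) simp
    then show "\<forall>\<^sub>F k in sequentially. \<forall>m<b n. D (prod_encode (n, m)) k (prefix_code p k)"
      by (rule eventually_mono) simp
  qed
qed

lemma semirecursive_graph_comp:
  assumes "semirecursive (\<lambda>p c. \<Phi> p (lproj c) = Some (rproj c))"
    and "total_recursive (\<lambda>p. f)" "total_recursive (\<lambda>p. g)"
  shows "semirecursive (\<lambda>p n. \<Phi> p (f n) = Some (g n))"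
  using semirecursive_comp[OF assms(1) total_recursive_pair[OF assms(2,3)]] by simp

lemma prod_encode_eq_iff: "prod_encode (a, b) = c \<longleftrightarrow> a = lproj c \<and> b = rproj c"
  by auto

lemma rec_nat_bind_eq_Some:
  "rec_nat x (\<lambda>k r. Option.bind r (h k)) n = Some v \<longleftrightarrow>
    (\<exists>s. x = Some (s 0) \<and> (\<forall>k<n. h k (s k) = Some (s (Suc k))) \<and> s n = v)"
proof (induction n arbitrary: v)
  case 0
  show ?case
    by auto
next
  case (Suc n)
  show ?case
  proof
    assume "rec_nat x (\<lambda>k r. Option.bind r (h k)) (Suc n) = Some v"
    then obtain y where "rec_nat x (\<lambda>k r. Option.bind r (h k)) n = Some y" "h n y = Some v"
      by (auto simp: bind_eq_Some_conv)
    then obtain s where "x = Some (s 0)" "\<forall>k<n. h k (s k) = Some (s (Suc k))" "h n (s n) = Some v"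
      unfolding Suc by blast
    then show "\<exists>s. x = Some (s 0) \<and> (\<forall>k<Suc n. h k (s k) = Some (s (Suc k))) \<and> s (Suc n) = v"
      by (intro exI[of _ "s(Suc n := v)"]) (auto simp: less_Suc_eq)
  next
    assume "\<exists>s. x = Some (s 0) \<and> (\<forall>k<Suc n. h k (s k) = Some (s (Suc k))) \<and> s (Suc n) = v"
    then obtain s where s: "x = Some (s 0)" "\<forall>k<Suc n. h k (s k) = Some (s (Suc k))" "s (Suc n) = v"
      by blast
    then have "rec_nat x (\<lambda>k r. Option.bind r (h k)) n = Some (s n)"
      unfolding Suc by (intro exI[of _ s]) simp
    with s show "rec_nat x (\<lambda>k r. Option.bind r (h k)) (Suc n) = Some v"
      by simp
  qed
qed

lemma rec_nat_bind_eq_Some_nth_code: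
  "rec_nat x (\<lambda>k r. Option.bind r (h k)) n = Some v \<longleftrightarrow>
    (\<exists>c. x = Some (nth_code c 0) \<and> (\<forall>k<n. h k (nth_code c k) = Some (nth_code c (Suc k))) \<and>
      nth_code c n = v)" (is "?lhs \<longleftrightarrow> ?rhs")
proof
  assume ?lhs
  then obtain s where s: "x = Some (s 0)" "\<forall>k<n. h k (s k) = Some (s (Suc k))" "s n = v"
    unfolding rec_nat_bind_eq_Some by blast
  obtain c where "\<forall>i\<le>n. nth_code c i = s i"
    using ex_nth_code by blast
  with s show ?rhs
    by (intro exI[of _ c]) (simp del: nth_code_simps)
next
  assume ?rhs
  then show ?lhs
    unfolding rec_nat_bind_eq_Some by blast
qed

lemma minimize_eq_Some:
  "minimize g = Some m \<longleftrightarrow> g m = Some 0 \<and> (\<forall>j<m. \<exists>v. g j = Some (Suc v))"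
proof -
  have "(LEAST n. g n = Some 0) = n" if "g n = Some 0" "\<forall>j<n. \<exists>v. g j = Some (Suc v)" for n
    using that by (intro Least_equality) (auto simp: not_less[symmetric])
  then show ?thesis
    unfolding minimize_def by auto
qed

lemma semirecursive_total_graph:
  assumes "total_recursive (\<lambda>p. f)"
  shows "semirecursive (\<lambda>p c. Some (f (lproj c)) = Some (rproj c))"
  unfolding option.inject
  by (intro semirecursive_oracle_free recursive_intros total_recursive_comp[OF assms])

lemma semirecursive_oracle_graph:
  "semirecursive (\<lambda>p c. Some (of_bool (p (lproj c))) = Some (rproj c))"
proof (rule semirecursiveI)
  show "recursive_pred3 (\<lambda>p c k w. lproj c < k \<and> of_bool (code_bit k w (lproj c)) = rproj c)"
    by (intro recursive_intros)
next
  fix p c assume graph: "Some (of_bool (p (lproj c))) = Some (rproj c)"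
  from eventually_gt_at_top[of "lproj c"] show "\<forall>\<^sub>F k in sequentially.
      lproj c < k \<and> of_bool (code_bit k (prefix_code p k) (lproj c)) = rproj c"
    by eventually_elim (use graph in \<open>simp add: code_bit_prefix_code\<close>)
qed (auto simp: code_bit_prefix_code)

text \<open>Kleene's normal form theorem. For primitive recursion, the intermediate values are guessed.\<close>

theorem semirecursive_graph:
  assumes "partial_recursive \<Phi>"
  shows "semirecursive (\<lambda>p c. \<Phi> p (lproj c) = Some (rproj c))"
  using assms
proof induction
  case pr_zero
  show ?case
    by (rule semirecursive_total_graph) (rule total_recursive_const)
next
  case pr_succ
  show ?case
    by (rule semirecursive_total_graph) (rule total_recursive_Suc_id)
next
  case pr_fst
  show ?case
    by (rule semirecursive_total_graph) (rule total_recursive_lproj_id)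
next
  case pr_snd
  show ?case
    by (rule semirecursive_total_graph) (rule total_recursive_rproj_id)
next
  case pr_oracle
  show ?case
    by (rule semirecursive_oracle_graph)
next
  case (pr_pair f g)
  have "Option.bind x (\<lambda>a. Option.bind y (\<lambda>b. Some (prod_encode (a, b)))) = Some c \<longleftrightarrow>
      x = Some (lproj c) \<and> y = Some (rproj c)" for x y c
    by (cases x; cases y) (auto simp: prod_encode_eq_iff)
  then show ?case
    by (simp only:)
       (intro semirecursive_intros pr_pair.IH[THEN semirecursive_graph_comp] recursive_intros)
next
  case (pr_comp f g)
  show ?case
    unfolding bind_eq_Some_conv
    by (intro semirecursive_intros pr_comp.IH[THEN semirecursive_graph_comp] recursive_intros)
next
  case (pr_rec f g)
  show ?case
    unfolding case_prod_unfold rec_nat_bind_eq_Some_nth_code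
    by (intro semirecursive_intros pr_rec.IH[THEN semirecursive_graph_comp]
        semirecursive_oracle_free recursive_intros)
next
  case (pr_min f)
  show ?case
    unfolding minimize_eq_Some
    by (intro semirecursive_intros pr_min.IH[THEN semirecursive_graph_comp] recursive_intros)
qed

lemma semirecursive_recursive_pred:
  assumes "recursive_pred P"
  shows "semirecursive P"
proof -
  have "semirecursive (\<lambda>p n. Some (of_bool (P p n)) = Some (1::nat))"
    using assms unfolding recursive_pred_def total_recursive_def
    by (intro semirecursive_graph[THEN semirecursive_graph_comp] recursive_intros)
  then show ?thesis
    by (simp only: option.inject of_bool_eq_1_iff)
qed

lemma semirecursive_oracle_comp:
  assumes "semirecursive R"
    and "recursive_pred2 q" "total_recursive g"
  shows "semirecursive (\<lambda>p n. R (q p n) (g p n))"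
proof -
  obtain D where D: "recursive_pred3 (\<lambda>p. D)"
      "\<And>p n. R p n \<longleftrightarrow> (\<exists>k. D n k (prefix_code p k))"
    using assms(1) by (auto simp: semirecursive_def)
  show ?thesis
    unfolding D(2)
    by (intro semirecursive_ex semirecursive_recursive_pred recursive_pred_comp3[OF D(1)]
        recursive_intros recursive_pred_comp2[OF assms(2)] total_recursive_comp[OF assms(3)])
qed

lemma semirecursive_comp2:
  assumes "semirecursive (\<lambda>p c. R p (lproj c) (rproj c))" "total_recursive f" "total_recursive g"
  shows "semirecursive (\<lambda>p n. R p (f p n) (g p n))"
proof -
  have "semirecursive (\<lambda>p n. (\<lambda>p c. R p (lproj c) (rproj c)) p (prod_encode (f p n, g p n)))"
    by (intro semirecursive_oracle_comp[OF assms(1)] recursive_intros assms(2,3))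
  then show ?thesis
    by simp
qed

lemma semirecursive_eq_Some:
  assumes "partial_recursive \<Phi>" "recursive_pred2 q"
    and "total_recursive f" "total_recursive g"
  shows "semirecursive (\<lambda>p n. \<Phi> (q p n) (f p n) = Some (g p n))"
  using semirecursive_oracle_comp[OF semirecursive_graph[OF assms(1)] assms(2)
      total_recursive_pair[OF assms(3,4)]] by simp

lemma semirecursive_imp [semirecursive_intros]:
  assumes "recursive_pred P" "semirecursive R"
  shows "semirecursive (\<lambda>p n. P p n \<longrightarrow> R p n)"
  unfolding imp_conv_disj
  by (intro semirecursive_disj semirecursive_recursive_pred recursive_pred_not assms)


section \<open>Semidecidable predicates on represented spaces\<close>

definition join :: "cantor \<Rightarrow> cantor \<Rightarrow> cantor" where
  "join t u n = (if even n then t (n div 2) else u (n div 2))"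

definition evens :: "cantor \<Rightarrow> cantor" where
  "evens t n = t (2 * n)"

definition odds :: "cantor \<Rightarrow> cantor" where
  "odds t n = t (2 * n + 1)"

lemma evens_join [simp]: "evens (join t u) = t"
  and odds_join [simp]: "odds (join t u) = u"
  and join_evens_odds [simp]: "join (evens t) (odds t) = t"
  by (auto simp: fun_eq_iff evens_def odds_def join_def odd_two_times_div_two_succ)

lemma recursive_pred_join [recursive_intros]:
  assumes "recursive_pred2 q" "recursive_pred2 r" "total_recursive h"
  shows "recursive_pred (\<lambda>p n. join (q p n) (r p n) (h p n))"
  unfolding join_def
  by (intro recursive_intros recursive_pred_comp2[OF assms(1)] recursive_pred_comp2[OF assms(2)]
      assms(3))

lemma recursive_pred_evens [recursive_intros]:
  assumes "recursive_pred2 q" "total_recursive h"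
  shows "recursive_pred (\<lambda>p n. evens (q p n) (h p n))"
  unfolding evens_def by (intro recursive_intros recursive_pred_comp2[OF assms(1)] assms(2))

lemma recursive_pred_odds [recursive_intros]:
  assumes "recursive_pred2 q" "total_recursive h"
  shows "recursive_pred (\<lambda>p n. odds (q p n) (h p n))"
  unfolding odds_def by (intro recursive_intros recursive_pred_comp2[OF assms(1)] assms(2))

lemma prod_rep_eq_Some:
  "prod_rep X Y p = Some w \<longleftrightarrow> X (evens p) = Some (fst w) \<and> Y (odds p) = Some (snd w)"
  by (cases w) (auto simp: prod_rep_def evens_def[abs_def] odds_def[abs_def] bind_eq_Some_conv)

definition semidecidable :: "'a rspace \<Rightarrow> ('a \<Rightarrow> nat \<Rightarrow> bool) \<Rightarrow> bool" where
  "semidecidable X P \<longleftrightarrow>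
     (\<exists>R. semirecursive R \<and> (\<forall>p x n. X p = Some x \<longrightarrow> (R p n \<longleftrightarrow> P x n)))"

lemma semidecidableI:
  assumes "semirecursive R" "\<And>p x n. X p = Some x \<Longrightarrow> R p n \<longleftrightarrow> P x n"
  shows "semidecidable X P"
  using assms unfolding semidecidable_def by blast

lemma semidecidableE:
  assumes "semidecidable X P"
  obtains R where "semirecursive R" "\<And>p x n. X p = Some x \<Longrightarrow> R p n \<longleftrightarrow> P x n"
  using assms unfolding semidecidable_def by blast

lemma semidecidable_prodI:
  assumes "semirecursive R"
    and "\<And>p q x y n. X p = Some x \<Longrightarrow> Y q = Some y \<Longrightarrow> R (join p q) n \<longleftrightarrow> P x y n"
  shows "semidecidable (prod_rep X Y) (\<lambda>(x, y). P x y)"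
proof (rule semidecidableI[OF assms(1)])
  fix p w n assume "prod_rep X Y p = Some w"
  then have "X (evens p) = Some (fst w)" "Y (odds p) = Some (snd w)"
    by (simp_all add: prod_rep_eq_Some)
  from assms(2)[OF this] show "R p n \<longleftrightarrow> (case w of (x, y) \<Rightarrow> P x y) n"
    by (simp add: case_prod_unfold)
qed

lemma semidecidable_prodE:
  assumes "semidecidable (prod_rep X Y) (\<lambda>(x, y). P x y)"
  obtains R where "semirecursive R"
    and "\<And>p q x y n. X p = Some x \<Longrightarrow> Y q = Some y \<Longrightarrow> R (join p q) n \<longleftrightarrow> P x y n"
proof -
  obtain R where R: "semirecursive R"
      "\<And>z w n. prod_rep X Y z = Some w \<Longrightarrow> R z n \<longleftrightarrow> (case w of (x, y) \<Rightarrow> P x y) n"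
    by (rule semidecidableE[OF assms]) (rule that)
  show thesis
  proof (rule that[OF R(1)])
    show "R (join p q) n \<longleftrightarrow> P x y n" if "X p = Some x" "Y q = Some y" for p q x y n
      using that R(2)[of "join p q" "(x, y)" n] by (simp add: prod_rep_eq_Some)
  qed
qed

lemma computable_map_codomain:
  assumes "computable_map X Y (\<lambda>x. Some (f x))"
    and "\<And>q x. x \<in> ran X \<Longrightarrow> Y q = Some (f x) \<Longrightarrow> Z q = Some (g x)"
  shows "computable_map X Z (\<lambda>x. Some (g x))"
proof -
  obtain F where F: "computable F" "realizes F X Y (\<lambda>x. Some (f x))"
    using assms(1) by (auto simp: computable_map_def)
  have "\<exists>q. F p = Some q \<and> Z q = Some (g x)" if "X p = Some x" for p x
    using F(2) that assms(2)[of x] ranI[of X, OF that] unfolding realizes_def by blast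
  then have "realizes F X Z (\<lambda>x. Some (g x))"
    by (simp add: realizes_def)
  with F(1) show ?thesis
    by (auto simp: computable_map_def)
qed

lemma semidecidable_computable_sierpinski:
  assumes "computable_map X sierpinski (\<lambda>x. Some (P x))"
  shows "semidecidable X (\<lambda>x n. P x)"
proof -
  obtain F \<Phi> where F: "realizes F X sierpinski (\<lambda>x. Some (P x))"
    and \<Phi>: "partial_recursive \<Phi>" "\<And>p q n. F p = Some q \<Longrightarrow> \<Phi> p n = Some (of_bool (q n))"
    using assms by (auto simp: computable_map_def computable_def)
  show ?thesis
  proof (rule semidecidableI)
    show "semirecursive (\<lambda>p n. \<exists>m. \<Phi> p m = Some 1)"
      by (intro semirecursive_intros semirecursive_eq_Some[OF \<Phi>(1)] recursive_intros)
  next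
    fix p x n assume "X p = Some x"
    with F obtain q where q: "F p = Some q" "sierpinski q = Some (P x)"
      unfolding realizes_def by blast
    then show "(\<exists>m. \<Phi> p m = Some 1) \<longleftrightarrow> P x"
      by (simp add: \<Phi>(2)[OF q(1)] sierpinski_def)
  qed
qed


subsection \<open>Membership in open sets\<close>

lemma least_witness_iff:
  fixes l :: "'a :: wellorder"
  shows "P l \<and> (\<forall>j<l. \<not> P j) \<longleftrightarrow> (\<exists>l. P l) \<and> l = (LEAST l. P l)"
proof
  assume "P l \<and> (\<forall>j<l. \<not> P j)"
  then show "(\<exists>l. P l) \<and> l = (LEAST l. P l)"
    by (auto intro!: Least_equality[symmetric] simp: not_less[symmetric])
next
  assume "(\<exists>l. P l) \<and> l = (LEAST l. P l)"
  then show "P l \<and> (\<forall>j<l. \<not> P j)"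
    using LeastI_ex[of P] not_less_Least[of _ P] by blast
qed

definition accepts :: "cantor \<Rightarrow> cantor \<Rightarrow> bool" where
  "accepts q r \<longleftrightarrow> (\<exists>n k. q (2 * prod_encode (n, prefix_code r k)) \<and>
     (\<forall>j<k. \<not> q (2 * prod_encode (n, prefix_code r j))) \<and>
     q (2 * prod_encode (n, prefix_code r k) + 1))"

lemma accepts_iff_associate:
  assumes "associate q r = Some b"
  shows "accepts q r \<longleftrightarrow> (\<exists>n. b n)"
proof -
  have "b n \<longleftrightarrow> (\<exists>k. (q (2 * prod_encode (n, prefix_code r k)) \<and>
      (\<forall>j<k. \<not> q (2 * prod_encode (n, prefix_code r j)))) \<and>
      q (2 * prod_encode (n, prefix_code r k) + 1))" for n
    unfolding least_witness_iff[of "\<lambda>k. q (2 * prod_encode (n, prefix_code r k))"]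
    using associate_SomeD[OF assms, of n] by simp
  then show ?thesis
    by (simp add: accepts_def)
qed

lemma semirecursive_accepts:
  assumes "semirecursive (\<lambda>p c. q p (lproj c) (rproj c))"
    and "semirecursive (\<lambda>p c. \<not> q p (lproj c) (rproj c))"
    and "recursive_pred2 r"
  shows "semirecursive (\<lambda>p n. accepts (q p n) (r p n))"
  unfolding accepts_def
  by (intro semirecursive_intros semirecursive_comp2[OF assms(1)] semirecursive_comp2[OF assms(2)]
      recursive_intros recursive_pred_comp2[OF assms(3)])

lemma mem_iff_accepts:
  assumes "open_rep X q = Some U" "X r = Some x"
  shows "x \<in> U \<longleftrightarrow> accepts q r"
proof -
  have "realizes (associate q) X sierpinski (\<lambda>y. Some ((\<lambda>x\<in>ran X. x \<in> U) y))"
    using assms(1) by (simp add: open_rep_eq_Some function_name_def)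
  with assms(2) obtain b where "associate q r = Some b" "sierpinski b = Some ((\<lambda>x\<in>ran X. x \<in> U) x)"
    unfolding realizes_def by blast
  with assms(2) show ?thesis
    by (simp add: accepts_iff_associate sierpinski_def ranI)
qed

lemma semidecidable_mem: "semidecidable (prod_rep (open_rep X) X) (\<lambda>(U, x) n. x \<in> U)"
proof (rule semidecidable_prodI)
  show "semirecursive (\<lambda>z n. accepts (evens z) (odds z))"
    by (intro semirecursive_accepts semirecursive_recursive_pred recursive_intros)
qed (simp add: mem_iff_accepts)

lemma semidecidable_mem_computable_sequence:
  assumes f: "computable_map Y (open_rep X) f"
    and z: "recursive_pred2 (\<lambda>p. z)"
    and "\<And>n. Y (z n) = Some (y n)" "\<And>n. f (y n) = Some (U n)"
  shows "semidecidable X (\<lambda>x n. x \<in> U n)"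
proof -
  obtain F \<Phi> where F: "realizes F Y (open_rep X) f"
    and \<Phi>: "partial_recursive \<Phi>" "\<And>p q n. F p = Some q \<Longrightarrow> \<Phi> p n = Some (of_bool (q n))"
    using f by (auto simp: computable_map_def computable_def)
  have "\<exists>q. F (z n) = Some q \<and> open_rep X q = Some (U n)" for n
    using F assms(3,4) unfolding realizes_def by blast
  then obtain q where q: "\<And>n. F (z n) = Some (q n)" "\<And>n. open_rep X (q n) = Some (U n)"
    by metis
  have q_iff: "q n i \<longleftrightarrow> \<Phi> (z n) i = Some 1" "\<not> q n i \<longleftrightarrow> \<Phi> (z n) i = Some 0" for n i
    by (simp_all add: \<Phi>(2)[OF q(1)])
  have "semirecursive (\<lambda>p c. q (lproj c) (rproj c))"
    unfolding q_iff(1)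
    by (intro semirecursive_eq_Some[OF \<Phi>(1)] recursive_intros recursive_pred_comp2[OF z])
  moreover have "semirecursive (\<lambda>p c. \<not> q (lproj c) (rproj c))"
    unfolding q_iff(2)
    by (intro semirecursive_eq_Some[OF \<Phi>(1)] recursive_intros recursive_pred_comp2[OF z])
  ultimately have "semirecursive (\<lambda>r n. accepts (q n) r)"
    by (intro semirecursive_accepts recursive_intros)
  then show ?thesis
    by (rule semidecidableI) (simp add: mem_iff_accepts[OF q(2)])
qed


subsection \<open>Names of open sets\<close>

lemma prefix_code_div_power2_eq_1: "prefix_code p k div 2 ^ j = 1 \<longleftrightarrow> k = j"
proof (cases "j \<le> k")
  case True
  have "prefix_code p i = 1 \<longleftrightarrow> i = 0" for i
    using prefix_code_length[of p i p 0] by auto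
  with True show ?thesis
    by (simp add: prefix_code_div_power2)
next
  case False
  then have "prefix_code p k < 2 ^ j"
    using prefix_code_bounds[of k p] power_increasing[of "Suc k" j "2::nat"] by linarith
  with False show ?thesis
    by simp
qed

lemma open_repI:
  assumes "U \<subseteq> ran X"
    and "\<And>r x. X r = Some x \<Longrightarrow> \<exists>b. associate q r = Some b \<and> ((\<exists>n. b n) \<longleftrightarrow> x \<in> U)"
  shows "open_rep X q = Some U"
proof -
  have "\<exists>b. associate q r = Some b \<and> sierpinski b = Some ((\<lambda>x\<in>ran X. x \<in> U) x)"
    if "X r = Some x" for r x
    using assms(2)[OF that] that by (auto simp: sierpinski_def ranI)
  with assms(1) show ?thesis
    by (simp add: open_rep_eq_Some function_name_def realizes_def)
qed

text \<open>Currying. The associate outputs its \<open>k\<close>-th bit after reading exactly \<open>k\<close> bits of its input.\<close>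

lemma recursive_open_names:
  assumes "semidecidable (prod_rep Y X) (\<lambda>(y, x) n. x \<in> U y n)"
    and "\<And>y n. y \<in> ran Y \<Longrightarrow> U y n \<subseteq> ran X"
  obtains C where "recursive_pred2 C"
    and "\<And>p y n. Y p = Some y \<Longrightarrow> open_rep X (C p n) = Some (U y n)"
proof -
  obtain R where R: "semirecursive R"
      "\<And>p r y x n. Y p = Some y \<Longrightarrow> X r = Some x \<Longrightarrow> R (join p r) n \<longleftrightarrow> x \<in> U y n"
    using assms(1) by (rule semidecidable_prodE) blast
  obtain D where D: "recursive_pred3 (\<lambda>p. D)"
      "\<And>p n. R p n \<longleftrightarrow> (\<exists>k. D n k (prefix_code p k))"
    using R(1) by (auto simp: semirecursive_def)
  define C where "C p n i \<longleftrightarrow>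
    (if even i then rproj (i div 2) div 2 ^ lproj (i div 2) = 1
     else D n (lproj (i div 2)) (prefix_code
       (join p (code_bit (lproj (i div 2)) (rproj (i div 2)))) (lproj (i div 2))))" for p n i
  have code_bit_join:
    "prefix_code (join p (code_bit k (prefix_code r k))) k = prefix_code (join p r) k" for p r k
    by (auto simp: prefix_code_eq_iff join_def intro!: code_bit_prefix_code)
  have "(LEAST j. j = k) = k" for k :: nat
    by (rule Least_equality) simp_all
  then have "associate (C p n) r = Some (\<lambda>k. D n k (prefix_code (join p r) k))" for p n r
    by (simp add: associate_def C_def prefix_code_div_power2_eq_1 code_bit_join del: One_nat_def)
  then have names: "open_rep X (C p n) = Some (U y n)" if "Y p = Some y" for p y n
    using assms(2)[OF ranI[of Y, OF that]] R(2)[OF that] by (intro open_repI) (simp_all add: D(2))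
  have "recursive_pred2 C"
    unfolding C_def by (intro recursive_intros recursive_pred_comp3[OF D(1)])
  then show thesis
    using names by (rule that)
qed

lemma computable_map_open_rep:
  assumes "semidecidable (prod_rep Y X) (\<lambda>(y, x) n. x \<in> U y)" "\<And>y. y \<in> ran Y \<Longrightarrow> U y \<subseteq> ran X"
  shows "computable_map Y (open_rep X) (\<lambda>y. Some (U y))"
proof -
  obtain C where C: "recursive_pred2 C"
      "\<And>p y n. Y p = Some y \<Longrightarrow> open_rep X (C p n) = Some (U y)"
    using recursive_open_names[OF assms] by blast
  show ?thesis
  proof (rule computable_map_recursive)
    show "recursive_pred (\<lambda>p. C p 0)"
      by (intro recursive_pred_comp2[OF C(1)] recursive_intros)
  qed (simp add: C(2))
qed


subsection \<open>Compact sets\<close>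

lemma compact_nameI:
  assumes X: "Hausdorff_space (rtop X)" and A: "compactin (rtop X) A"
    and "open_rep (open_rep X) q = Some {U \<in> ran (open_rep X). A \<subseteq> U}"
  shows "compact_name X q A"
proof -
  have "\<exists>U. openin (rtop X) U \<and> A \<subseteq> U \<and> x \<notin> U" if "x \<notin> A" for x
  proof (intro exI conjI)
    show "openin (rtop X) (topspace (rtop X) - {x})"
      using Hausdorff_imp_t1_space[OF X] openin_topspace
      unfolding t1_space_openin_delete_alt by blast
    show "A \<subseteq> topspace (rtop X) - {x}"
      using compactin_subset_topspace[OF A] that by blast
  qed simp
  then have "A = \<Inter>{U. openin (rtop X) U \<and> A \<subseteq> U}"
    by blast
  with assms show ?thesis
    by (simp add: compact_name_def)
qed

lemma semidecidable_compact_subset: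
  assumes "semidecidable X (\<lambda>x n. x \<in> U n)" "\<And>n. U n \<subseteq> ran X"
  shows "semidecidable (compact_rep X) (\<lambda>A n. A \<subseteq> U n)"
proof -
  obtain R where R: "semirecursive R" "\<And>r x n. X r = Some x \<Longrightarrow> R r n \<longleftrightarrow> x \<in> U n"
    using assms(1) by (rule semidecidableE) blast
  have "semirecursive (\<lambda>z n. R (odds z) n)"
    by (intro semirecursive_oracle_comp[OF R(1)] recursive_intros)
  then have "semidecidable (prod_rep (compact_rep X) X) (\<lambda>(A, x) n. x \<in> U n)"
    by (rule semidecidable_prodI) (simp add: R(2))
  then obtain C where C: "recursive_pred2 C"
      "\<And>q A n. compact_rep X q = Some A \<Longrightarrow> open_rep X (C q n) = Some (U n)"
    using recursive_open_names[of "compact_rep X" X "\<lambda>A. U"] assms(2) by blast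
  obtain M where M: "semirecursive M"
      "\<And>q r \<U> U n. open_rep (open_rep X) q = Some \<U> \<Longrightarrow> open_rep X r = Some U \<Longrightarrow>
        M (join q r) n \<longleftrightarrow> U \<in> \<U>"
    using semidecidable_mem[of "open_rep X"] by (rule semidecidable_prodE) blast
  show ?thesis
  proof (rule semidecidableI)
    show "semirecursive (\<lambda>q n. M (join q (C q n)) n)"
      by (intro semirecursive_oracle_comp[OF M(1)] recursive_intros recursive_pred_comp2[OF C(1)])
  next
    fix q A n assume q: "compact_rep X q = Some A"
    then have "open_rep (open_rep X) q = Some {U \<in> ran (open_rep X). A \<subseteq> U}"
      by (simp add: compact_rep_eq_Some compact_name_def)
    then show "M (join q (C q n)) n \<longleftrightarrow> A \<subseteq> U n"
      using M(2)[OF _ C(2)[OF q]] ranI[of "open_rep X", OF C(2)[OF q]] by simp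
  qed
qed

lemma semidecidable_all_computably_compact:
  assumes "computably_compact X" "semidecidable (prod_rep Y X) (\<lambda>(y, x). P y x)"
  shows "semidecidable Y (\<lambda>y n. \<forall>x\<in>ran X. P y x n)"
proof -
  obtain E where E: "semirecursive E" "\<And>q A n. closed_rep X q = Some A \<Longrightarrow> E q n \<longleftrightarrow> A = {}"
    using semidecidable_computable_sierpinski[OF assms(1)[unfolded computably_compact_def]]
    by (rule semidecidableE) blast
  obtain R where R: "semirecursive R"
      "\<And>p r y x n. Y p = Some y \<Longrightarrow> X r = Some x \<Longrightarrow> R (join p r) n \<longleftrightarrow> P y x n"
    using assms(2) by (rule semidecidable_prodE) blast
  have "semidecidable (prod_rep Y X) (\<lambda>(y, x) n. x \<in> {x \<in> ran X. P y x n})"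
    by (rule semidecidable_prodI[OF R(1)]) (simp add: R(2) ranI)
  then obtain C where C: "recursive_pred2 C"
      "\<And>p y n. Y p = Some y \<Longrightarrow> open_rep X (C p n) = Some {x \<in> ran X. P y x n}"
    by (rule recursive_open_names) blast+
  show ?thesis
  proof (rule semidecidableI)
    show "semirecursive (\<lambda>p n. E (C p n) n)"
      by (intro semirecursive_oracle_comp[OF E(1)] recursive_intros recursive_pred_comp2[OF C(1)])
  next
    fix p y n assume "Y p = Some y"
    then have "closed_rep X (C p n) = Some (ran X - {x \<in> ran X. P y x n})"
      by (simp add: closed_rep_def C(2))
    then show "E (C p n) n \<longleftrightarrow> (\<forall>x\<in>ran X. P y x n)"
      by (auto simp: E(2))
  qed
qed

lemma semidecidable_open_superset:
  assumes "computably_compact X" and "semidecidable (prod_rep Y X) (\<lambda>(A, x) n. x \<notin> A)"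
    and "\<And>A. A \<in> ran Y \<Longrightarrow> A \<subseteq> ran X"
  shows "semidecidable (prod_rep Y (open_rep X)) (\<lambda>(A, U) n. A \<subseteq> U)"
proof -
  obtain N where N: "semirecursive N"
      "\<And>p r A x n. Y p = Some A \<Longrightarrow> X r = Some x \<Longrightarrow> N (join p r) n \<longleftrightarrow> x \<notin> A"
    using assms(2) by (rule semidecidable_prodE) blast
  obtain M where M: "semirecursive M"
      "\<And>u r U x n. open_rep X u = Some U \<Longrightarrow> X r = Some x \<Longrightarrow> M (join u r) n \<longleftrightarrow> x \<in> U"
    using semidecidable_mem[of X] by (rule semidecidable_prodE) blast
  have "semidecidable (prod_rep (prod_rep Y (open_rep X)) X)
      (\<lambda>(w, x) n. x \<in> fst w \<longrightarrow> x \<in> snd w)"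
  proof (rule semidecidable_prodI)
    show "semirecursive (\<lambda>z n. N (join (evens (evens z)) (odds z)) n \<or>
        M (join (odds (evens z)) (odds z)) n)"
      by (intro semirecursive_disj semirecursive_oracle_comp[OF N(1)]
          semirecursive_oracle_comp[OF M(1)] recursive_intros)
  next
    fix q r w x n assume "prod_rep Y (open_rep X) q = Some w" and x: "X r = Some x"
    then have "Y (evens q) = Some (fst w)" "open_rep X (odds q) = Some (snd w)"
      by (simp_all add: prod_rep_eq_Some)
    then show "N (join (evens (evens (join q r))) (odds (join q r))) n \<or>
        M (join (odds (evens (join q r))) (odds (join q r))) n \<longleftrightarrow> x \<in> fst w \<longrightarrow> x \<in> snd w"
      using N(2)[OF _ x] M(2)[OF _ x] by auto
  qed
  from semidecidable_all_computably_compact[OF assms(1) this] obtain R where R: "semirecursive R"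
      "\<And>q w n. prod_rep Y (open_rep X) q = Some w \<Longrightarrow>
        R q n \<longleftrightarrow> (\<forall>x\<in>ran X. x \<in> fst w \<longrightarrow> x \<in> snd w)"
    by (rule semidecidableE) blast
  show ?thesis
  proof (rule semidecidable_prodI[OF R(1)])
    show "R (join p u) n \<longleftrightarrow> A \<subseteq> U" if "Y p = Some A" "open_rep X u = Some U" for p u A U n
      using that assms(3)[of A] R(2)[of "join p u" "(A, U)"] by (auto simp: prod_rep_eq_Some ranI)
  qed
qed

lemma computable_map_compact_rep:
  assumes X: "computably_compact X" "Hausdorff_space (rtop X)"
    and N: "semidecidable (prod_rep Y X) (\<lambda>(A, x) n. x \<notin> A)"
    and A: "\<And>A. A \<in> ran Y \<Longrightarrow> compactin (rtop X) A"
  shows "computable_map Y (compact_rep X) Some"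
proof -
  have "semidecidable (prod_rep Y (open_rep X)) (\<lambda>(A, U) n. A \<subseteq> U)"
    using A compactin_subset_topspace[of "rtop X"]
    by (intro semidecidable_open_superset[OF X(1) N]) simp
  then obtain R where R: "semirecursive R"
      "\<And>p u A U n. Y p = Some A \<Longrightarrow> open_rep X u = Some U \<Longrightarrow> R (join p u) n \<longleftrightarrow> A \<subseteq> U"
    by (rule semidecidable_prodE) blast
  then have "semidecidable (prod_rep Y (open_rep X)) (\<lambda>(A, U) n. U \<in> {U \<in> ran (open_rep X). A \<subseteq> U})"
    by (intro semidecidable_prodI[OF R(1)]) (auto intro: ranI)
  then have "computable_map Y (open_rep (open_rep X)) (\<lambda>A. Some {U \<in> ran (open_rep X). A \<subseteq> U})"
    by (rule computable_map_open_rep) blast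
  then show ?thesis
  proof (rule computable_map_codomain)
    show "compact_rep X q = Some A"
      if "A \<in> ran Y" "open_rep (open_rep X) q = Some {U \<in> ran (open_rep X). A \<subseteq> U}" for q A
      using compact_nameI[OF X(2) A that(2)] that(1) by (simp add: compact_rep_eq_Some)
  qed
qed


subsection \<open>Sequences in Plotkin's space\<close>

lemma plotkin_seq_rep_eq_Some:
  "plotkin_seq_rep t = Some p \<longleftrightarrow> (\<forall>n. p n =
     (if \<exists>l. t (prod_encode (n, l)) then Some (odd (LEAST l. t (prod_encode (n, l)))) else None))"
  by (auto simp: plotkin_seq_rep_def seq_rep_def plotkin_rep_def dom_def fun_eq_iff)

lemma semidecidable_plotkin_seq: "semidecidable plotkin_seq_rep (\<lambda>p n. p n = Some a)"
proof (rule semidecidableI)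
  show "semirecursive (\<lambda>t n. \<exists>l.
      (t (prod_encode (n, l)) \<and> (\<forall>j<l. \<not> t (prod_encode (n, j)))) \<and> odd l = a)"
    by (intro semirecursive_ex semirecursive_recursive_pred recursive_intros)
next
  fix t p n assume "plotkin_seq_rep t = Some p"
  then show "(\<exists>l. (t (prod_encode (n, l)) \<and> (\<forall>j<l. \<not> t (prod_encode (n, j)))) \<and> odd l = a) \<longleftrightarrow>
      p n = Some a"
    unfolding least_witness_iff[of "\<lambda>l. t (prod_encode (n, l))"]
    by (simp add: plotkin_seq_rep_eq_Some)
qed

lemma computable_map_plotkin_seq_rep:
  assumes "semidecidable X P"
  shows "computable_map X plotkin_seq_rep (\<lambda>x. Some (\<lambda>n. if P x n then Some a else None))"
proof -
  obtain R where R: "semirecursive R" "\<And>p x n. X p = Some x \<Longrightarrow> R p n \<longleftrightarrow> P x n"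
    using assms by (rule semidecidableE) blast
  obtain D where D: "recursive_pred3 (\<lambda>p. D)"
      "\<And>p n. R p n \<longleftrightarrow> (\<exists>k. D n k (prefix_code p k))"
    using R(1) by (auto simp: semirecursive_def)
  define T where "T p c \<longleftrightarrow> odd (rproj c) = a \<and>
    D (lproj c) (rproj c div 2) (prefix_code p (rproj c div 2))" for p c
  have "plotkin_seq_rep (T p) = Some (\<lambda>n. if R p n then Some a else None)" for p
    unfolding plotkin_seq_rep_eq_Some
  proof
    fix n
    have "T p (prod_encode (n, 2 * k + of_bool a)) \<longleftrightarrow> D n k (prefix_code p k)" for k
      by (simp add: T_def)
    moreover have "D n (l div 2) (prefix_code p (l div 2))" if "T p (prod_encode (n, l))" for l
      using that by (simp add: T_def)
    ultimately have "(\<exists>l. T p (prod_encode (n, l))) \<longleftrightarrow> R p n"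
      unfolding D(2) by blast
    moreover have "odd (LEAST l. T p (prod_encode (n, l))) = a" if "\<exists>l. T p (prod_encode (n, l))"
      using LeastI_ex[OF that] by (simp add: T_def)
    ultimately show "(if R p n then Some a else None) = (if \<exists>l. T p (prod_encode (n, l))
        then Some (odd (LEAST l. T p (prod_encode (n, l)))) else None)"
      by simp
  qed
  moreover have "recursive_pred T"
    unfolding T_def by (intro recursive_intros recursive_pred_comp3[OF D(1)])
  ultimately show ?thesis
    by (intro computable_map_recursive[of T]) (auto simp: R(2))
qed


section \<open>Cells of a dyadic subbase\<close>

definition finite_seq_decode :: "nat \<Rightarrow> nat \<Rightarrow> plotkin" where
  "finite_seq_decode m k = (if k \<in> set_decode (lproj m) then Some False
     else if k \<in> set_decode (rproj m) then Some True else None)"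

abbreviation nth_cell :: "'a rspace \<Rightarrow> (nat \<Rightarrow> bool \<Rightarrow> 'a set) \<Rightarrow> nat \<Rightarrow> 'a set" where
  "nth_cell X S m \<equiv> subbase_cell X S (finite_seq_decode m)"

abbreviation nth_exterior :: "'a rspace \<Rightarrow> (nat \<Rightarrow> bool \<Rightarrow> 'a set) \<Rightarrow> nat \<Rightarrow> 'a set" where
  "nth_exterior X S m \<equiv> ran X - subbase_closed_cell X S (finite_seq_decode m)"

lemma set_decode_less:
  assumes "k \<in> set_decode n"
  shows "k < n"
proof -
  have "2 ^ k \<le> n"
    using assms by (intro leI) (auto simp: set_decode_def)
  then show ?thesis
    using less_exp[of k] by linarith
qed

lemma finite_seq_decode_less:
  assumes "finite_seq_decode m k = Some a"
  shows "k < m"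
proof -
  have "lproj m \<le> m" "rproj m \<le> m"
    using le_prod_encode_1[of "lproj m" "rproj m"] le_prod_encode_2[of "rproj m" "lproj m"]
    by simp_all
  then show ?thesis
    using assms set_decode_less[of k "lproj m"] set_decode_less[of k "rproj m"]
    by (auto simp: finite_seq_decode_def split: if_splits)
qed

lemma ex_finite_seq_decode:
  assumes "finite (dom p)"
  shows "\<exists>m. finite_seq_decode m = p"
proof
  have "finite {k. p k = Some a}" for a
    by (rule finite_subset[OF _ assms]) auto
  then have "finite_seq_decode (prod_encode (set_encode {k. p k = Some False},
      set_encode {k. p k = Some True})) k = p k" for k
    by (cases "p k") (auto simp: finite_seq_decode_def)
  then show "finite_seq_decode (prod_encode (set_encode {k. p k = Some False},
      set_encode {k. p k = Some True})) = p" ..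
qed

lemma finite_seq_decode_eq_finite_seq:
  "finite_seq_decode m = finite_seq (map (finite_seq_decode m) [0..<m])"
proof
  show "finite_seq_decode m k = finite_seq (map (finite_seq_decode m) [0..<m]) k" for k
    using finite_seq_decode_less[of m k]
    by (cases "finite_seq_decode m k") (auto simp: finite_seq_def)
qed

lemma recursive_pred_finite_seq_decode [recursive_intros]:
  assumes "total_recursive f" "total_recursive g"
  shows "recursive_pred (\<lambda>p n. finite_seq_decode (f p n) (g p n) = Some a)"
proof -
  have "finite_seq_decode m k = Some a \<longleftrightarrow>
      (if odd (lproj m div 2 ^ k) then \<not> a else odd (rproj m div 2 ^ k) \<and> a)" for m k
    by (auto simp: finite_seq_decode_def set_decode_def)
  then show ?thesis
    by (simp only:) (intro recursive_intros assms)
qed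

lemma semidecidable_subbase:
  assumes "computable_map (prod_rep nat_rep bit_rep) (open_rep X) (\<lambda>(n, i). Some (S n i))"
  shows "semidecidable X (\<lambda>x c. x \<in> S (lproj c) (odd (rproj c)))"
proof (rule semidecidable_mem_computable_sequence[OF assms])
  show "recursive_pred2 (\<lambda>p c. join (\<lambda>i. i = lproj c) (\<lambda>i. odd (rproj c)))"
    by (intro recursive_intros)
  have "nat_rep (\<lambda>i. i = k) = Some k" for k
    by (auto simp: nat_rep_def intro: Least_equality)
  then show "prod_rep nat_rep bit_rep (join (\<lambda>i. i = lproj c) (\<lambda>i. odd (rproj c))) =
      Some (lproj c, odd (rproj c))" for c
    by (simp add: prod_rep_eq_Some bit_rep_def)
qed simp

lemma semidecidable_nth_cell:
  assumes "computable_map (prod_rep nat_rep bit_rep) (open_rep X) (\<lambda>(n, i). Some (S n i))"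
  shows "semidecidable X (\<lambda>x m. x \<in> nth_cell X S m)"
proof -
  obtain R where R: "semirecursive R"
      "\<And>r x c. X r = Some x \<Longrightarrow> R r c \<longleftrightarrow> x \<in> S (lproj c) (odd (rproj c))"
    by (rule semidecidableE[OF semidecidable_subbase[OF assms]]) blast
  show ?thesis
  proof (rule semidecidableI)
    show "semirecursive (\<lambda>r m. \<forall>k<m. \<forall>a. finite_seq_decode m k = Some a \<longrightarrow>
        R r (prod_encode (k, of_bool a)))"
      unfolding all_bool_eq
      by (intro semirecursive_intros semirecursive_comp[OF R(1)] semirecursive_recursive_pred
          recursive_intros)
    show "(\<forall>k<m. \<forall>a. finite_seq_decode m k = Some a \<longrightarrow> R r (prod_encode (k, of_bool a))) \<longleftrightarrow>
        x \<in> nth_cell X S m" if "X r = Some x" for r x m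
      using ranI[of X, OF that] finite_seq_decode_less[of m]
      by (auto simp: R(2)[OF that] subbase_cell_def)
  qed
qed

lemma semidecidable_nth_exterior:
  assumes "computable_map (prod_rep nat_rep bit_rep) (open_rep X) (\<lambda>(n, i). Some (S n i))"
  shows "semidecidable X (\<lambda>x m. x \<in> nth_exterior X S m)"
proof -
  obtain R where R: "semirecursive R"
      "\<And>r x c. X r = Some x \<Longrightarrow> R r c \<longleftrightarrow> x \<in> S (lproj c) (odd (rproj c))"
    by (rule semidecidableE[OF semidecidable_subbase[OF assms]]) blast
  show ?thesis
  proof (rule semidecidableI)
    show "semirecursive (\<lambda>r m. \<exists>k a. finite_seq_decode m k = Some a \<and>
        R r (prod_encode (k, of_bool (\<not> a))))"
      unfolding ex_bool_eq
      by (intro semirecursive_intros semirecursive_comp[OF R(1)] semirecursive_recursive_pred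
          recursive_intros)
    show "(\<exists>k a. finite_seq_decode m k = Some a \<and> R r (prod_encode (k, of_bool (\<not> a)))) \<longleftrightarrow>
        x \<in> nth_exterior X S m" if "X r = Some x" for r x m
      using ranI[of X, OF that] by (auto simp: R(2)[OF that] subbase_closed_cell_def)
  qed
qed

lemma dyadic_subbase_disjoint:
  assumes "dyadic_subbase X S" "x \<in> S n a" "x \<in> S n b"
  shows "a = b"
  using assms by (cases a; cases b) (auto simp: dyadic_subbase_def)

lemma subbase_subset:
  assumes "dyadic_subbase X S"
  shows "S n a \<subseteq> ran X"
proof -
  have "openin (rtop X) (S n a)"
    using assms unfolding dyadic_subbase_def ran_open_rep by blast
  from openin_subset[OF this] show ?thesis
    by simp
qed

lemma subbase_cell_subset_closed_cell:
  assumes "dyadic_subbase X S"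
  shows "subbase_cell X S p \<subseteq> subbase_closed_cell X S p"
  using dyadic_subbase_disjoint[OF assms]
  by (fastforce simp: subbase_cell_def subbase_closed_cell_def)

lemma subbase_cell_map_add:
  assumes S: "dyadic_subbase X S" and x: "x \<in> subbase_cell X S p" "x \<in> subbase_cell X S q"
  shows "subbase_cell X S (p ++ q) = subbase_cell X S p \<inter> subbase_cell X S q"
proof -
  have "a = b" if "p k = Some a" "q k = Some b" for k a b
    using x that dyadic_subbase_disjoint[OF S] unfolding subbase_cell_def by blast
  then have "(p ++ q) k = Some a \<longleftrightarrow> p k = Some a \<or> q k = Some a" for k a
    by (cases "q k") (auto simp: map_add_def)
  then show ?thesis
    by (auto simp: subbase_cell_def)
qed

lemma subbase_cells_form_base:
  assumes S: "dyadic_subbase X S" and U: "openin (rtop X) U" "x \<in> U"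
  obtains p where "finite (dom p)" "x \<in> subbase_cell X S p" "subbase_cell X S p \<subseteq> U"
proof -
  have "rtop X = topology_generated_by (insert (ran X) {S n i | n i. True})"
    using S unfolding dyadic_subbase_def by blast
  with U(1) have "generate_topology_on (insert (ran X) {S n i | n i. True}) U"
    using openin_topology_generated_by by metis
  then have "\<exists>p. finite (dom p) \<and> x \<in> subbase_cell X S p \<and> subbase_cell X S p \<subseteq> U"
    using U(2)
  proof (induction U)
    case (Int U V)
    then obtain p q where p: "finite (dom p)" "x \<in> subbase_cell X S p" "subbase_cell X S p \<subseteq> U"
      and q: "finite (dom q)" "x \<in> subbase_cell X S q" "subbase_cell X S q \<subseteq> V"
      by blast
    with subbase_cell_map_add[OF S p(2) q(2)] show ?case
      by (intro exI[of _ "p ++ q"]) auto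
  next
    case (UN K)
    then show ?case
      by blast
  next
    case (Basis V)
    then consider (whole) "V = ran X" | (subbasic) n i where "V = S n i"
      by blast
    then show ?case
    proof cases
      case whole
      with Basis show ?thesis
        by (intro exI[of _ Map.empty]) (simp add: subbase_cell_def)
    next
      case subbasic
      have "subbase_cell X S [n \<mapsto> i] = S n i"
        using subbase_subset[OF S, of n i] by (auto simp: subbase_cell_def split: if_splits)
      with subbasic Basis show ?thesis
        by (intro exI[of _ "[n \<mapsto> i]"]) (simp del: fun_upd_apply)
    qed
  qed simp
  with that show thesis
    by blast
qed

lemma compact_separated_by_nth_cell:
  assumes S: "dyadic_subbase X S" "proper_subbase X S" and X: "Hausdorff_space (rtop X)"
    and A: "compactin (rtop X) A" and x: "x \<in> ran X" "x \<notin> A"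
  obtains m where "x \<in> nth_cell X S m" "A \<subseteq> nth_exterior X S m"
proof -
  have "compactin (rtop X) {x}" "disjnt {x} A"
    using x by simp_all
  then obtain U V where UV: "openin (rtop X) U" "openin (rtop X) V" "x \<in> U" "A \<subseteq> V" "disjnt U V"
    using Hausdorff_space_compact_separation[OF X _ A] by (metis insert_subset)
  then obtain p where "finite (dom p)" "x \<in> subbase_cell X S p" "subbase_cell X S p \<subseteq> U"
    using subbase_cells_form_base[OF S(1)] by blast
  then obtain m where m: "x \<in> nth_cell X S m" "nth_cell X S m \<subseteq> U"
    using ex_finite_seq_decode by metis
  have "rtop X closure_of nth_cell X S m = subbase_closed_cell X S (finite_seq_decode m)"
    using S(2) finite_seq_decode_eq_finite_seq[of m] unfolding proper_subbase_def by metis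
  moreover have "V \<inter> rtop X closure_of nth_cell X S m = {}"
    using UV(5) m(2) unfolding openin_Int_closure_of_eq_empty[OF UV(2)] disjnt_def by blast
  ultimately have "A \<subseteq> nth_exterior X S m"
    using UV(4) compactin_subset_topspace[OF A] by auto
  with m(1) show thesis
    by (rule that)
qed


section \<open>The matching representations\<close>

definition point_rep :: "'a rspace \<Rightarrow> (nat \<Rightarrow> bool \<Rightarrow> 'a set) \<Rightarrow> 'a rspace" where
  "point_rep X S q = Option.bind (X (evens q)) (\<lambda>x.
     if \<forall>m. x \<in> nth_cell X S m \<longrightarrow> odds q m then Some x else None)"

definition avoiding_set ::
  "'a rspace \<Rightarrow> (nat \<Rightarrow> bool \<Rightarrow> 'a set) \<Rightarrow> (nat \<Rightarrow> plotkin) \<Rightarrow> 'a set" where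
  "avoiding_set X S p = {x \<in> ran X. \<forall>m. p (2 * m + 1) = Some False \<longrightarrow> x \<notin> nth_cell X S m}"

definition set_rep :: "'a rspace \<Rightarrow> (nat \<Rightarrow> bool \<Rightarrow> 'a set) \<Rightarrow> (nat \<Rightarrow> plotkin) \<rightharpoonup> 'a set" where
  "set_rep X S p =
     (if (\<forall>n. p (2 * n) = None) \<and> compactin (rtop X) (avoiding_set X S p)
      then Some (avoiding_set X S p) else None)"

definition exterior_name ::
  "'a rspace \<Rightarrow> (nat \<Rightarrow> bool \<Rightarrow> 'a set) \<Rightarrow> 'a set \<Rightarrow> (nat \<Rightarrow> plotkin)" where
  "exterior_name X S A n = (if odd n \<and> A \<subseteq> nth_exterior X S (n div 2) then Some False else None)"

lemma point_rep_eq_Some: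
  "point_rep X S q = Some x \<longleftrightarrow>
     X (evens q) = Some x \<and> (\<forall>m. x \<in> nth_cell X S m \<longrightarrow> odds q m)"
  by (auto simp: point_rep_def bind_eq_Some_conv)

lemma set_rep_eq_Some:
  "set_rep X S p = Some A \<longleftrightarrow>
     (\<forall>n. p (2 * n) = None) \<and> A = avoiding_set X S p \<and> compactin (rtop X) A"
  by (auto simp: set_rep_def)

lemma rep_equiv_point_rep: "rep_equiv (point_rep X S) X"
proof -
  have "computable_map (point_rep X S) X Some"
  proof (rule computable_map_recursive)
    show "recursive_pred evens"
      by (intro recursive_intros)
  qed (simp add: point_rep_eq_Some)
  moreover have "computable_map X (point_rep X S) Some"
  proof (rule computable_map_recursive)
    show "recursive_pred (\<lambda>r. join r (\<lambda>n. True))"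
      by (intro recursive_intros)
  qed (simp add: point_rep_eq_Some)
  ultimately show ?thesis
    by (simp add: rep_equiv_def)
qed

lemma refines_total_seq_iff:
  assumes "\<And>n. p (2 * n) = None"
  shows "p \<preceq>\<^sub>T total_seq q \<longleftrightarrow> (\<forall>m a. p (2 * m + 1) = Some a \<longrightarrow> odds q m = a)"
proof
  assume "p \<preceq>\<^sub>T total_seq q"
  then show "\<forall>m a. p (2 * m + 1) = Some a \<longrightarrow> odds q m = a"
    unfolding refines_def total_seq_def odds_def by (metis option.distinct(1) option.inject)
next
  assume odds: "\<forall>m a. p (2 * m + 1) = Some a \<longrightarrow> odds q m = a"
  have "p n = Some (q n)" if "p n = Some a" for n a
  proof -
    have "odd n"
      using assms that by (auto elim: evenE)
    then obtain m where "n = 2 * m + 1" ..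
    with odds that show ?thesis
      by (simp add: odds_def)
  qed
  then show "p \<preceq>\<^sub>T total_seq q"
    unfolding refines_def total_seq_def by auto
qed

lemma mem_set_rep_iff_ex_refinement:
  assumes p: "set_rep X S p = Some A" and x: "x \<in> ran X"
  shows "x \<in> A \<longleftrightarrow> (\<exists>q. p \<preceq>\<^sub>T total_seq q \<and> point_rep X S q = Some x)"
proof -
  have A: "A = avoiding_set X S p" and refines: "p \<preceq>\<^sub>T total_seq q \<longleftrightarrow>
      (\<forall>m a. p (2 * m + 1) = Some a \<longrightarrow> odds q m = a)" for q
    using p by (simp_all add: set_rep_eq_Some refines_total_seq_iff)
  show ?thesis
  proof
    assume "x \<in> A"
    obtain r where "X r = Some x"
      using x by (auto simp: ran_def)
    with \<open>x \<in> A\<close> show "\<exists>q. p \<preceq>\<^sub>T total_seq q \<and> point_rep X S q = Some x"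
      unfolding refines A
      by (intro exI[of _ "join r (\<lambda>m. p (2 * m + 1) \<noteq> Some False)"])
         (auto simp: point_rep_eq_Some avoiding_set_def)
  next
    assume "\<exists>q. p \<preceq>\<^sub>T total_seq q \<and> point_rep X S q = Some x"
    with x show "x \<in> A"
      unfolding refines A point_rep_eq_Some avoiding_set_def by blast
  qed
qed

lemma set_rep_exterior_name:
  assumes S: "dyadic_subbase X S" "proper_subbase X S" and X: "Hausdorff_space (rtop X)"
    and A: "compactin (rtop X) A"
  shows "set_rep X S (exterior_name X S A) = Some A"
proof -
  have "\<exists>m. A \<subseteq> nth_exterior X S m \<and> x \<in> nth_cell X S m" if "x \<in> ran X" "x \<notin> A" for x
    using compact_separated_by_nth_cell[OF S X A that] by blast
  moreover have "A \<subseteq> ran X"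
    using compactin_subset_topspace[OF A] by simp
  ultimately have "A = {x \<in> ran X. \<forall>m. A \<subseteq> nth_exterior X S m \<longrightarrow> x \<notin> nth_cell X S m}"
    using subbase_cell_subset_closed_cell[OF S(1)] by blast
  with A show ?thesis
    by (simp add: set_rep_eq_Some avoiding_set_def exterior_name_def)
qed

lemma ran_set_rep:
  assumes "dyadic_subbase X S" "proper_subbase X S" "Hausdorff_space (rtop X)"
  shows "ran (set_rep X S) = {A. compactin (rtop X) A}"
  using set_rep_exterior_name[OF assms] by (auto simp: ran_def set_rep_eq_Some)

lemma computable_map_set_rep_compact_rep:
  assumes S: "computable_map (prod_rep nat_rep bit_rep) (open_rep X) (\<lambda>(n, i). Some (S n i))"
    and X: "computably_compact X" "Hausdorff_space (rtop X)"
  shows "computable_map (set_rep X S \<circ>\<^sub>m plotkin_seq_rep) (compact_rep X) Some"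
proof (rule computable_map_compact_rep[OF X])
  obtain R where R: "semirecursive R" "\<And>r x m. X r = Some x \<Longrightarrow> R r m \<longleftrightarrow> x \<in> nth_cell X S m"
    by (rule semidecidableE[OF semidecidable_nth_cell[OF S]]) blast
  obtain T where T: "semirecursive T"
      "\<And>t p n. plotkin_seq_rep t = Some p \<Longrightarrow> T t n \<longleftrightarrow> p n = Some False"
    by (rule semidecidableE[OF semidecidable_plotkin_seq]) blast
  show "semidecidable (prod_rep (set_rep X S \<circ>\<^sub>m plotkin_seq_rep) X) (\<lambda>(A, x) n. x \<notin> A)"
  proof (rule semidecidable_prodI)
    show "semirecursive (\<lambda>z n. \<exists>m. T (evens z) (2 * m + 1) \<and> R (odds z) m)"
      by (intro semirecursive_intros semirecursive_oracle_comp[OF T(1)]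
          semirecursive_oracle_comp[OF R(1)] recursive_intros)
  next
    fix t r A x n assume "(set_rep X S \<circ>\<^sub>m plotkin_seq_rep) t = Some A" and r: "X r = Some x"
    then obtain p where "plotkin_seq_rep t = Some p" "A = avoiding_set X S p"
      by (auto simp: map_comp_Some_iff set_rep_eq_Some)
    with ranI[of X, OF r]
    show "(\<exists>m. T (evens (join t r)) (2 * m + 1) \<and> R (odds (join t r)) m) \<longleftrightarrow> x \<notin> A"
      by (simp add: T(2) R(2)[OF r] avoiding_set_def)
  qed
next
  show "compactin (rtop X) A" if "A \<in> ran (set_rep X S \<circ>\<^sub>m plotkin_seq_rep)" for A
    using that by (auto simp: ran_def map_comp_Some_iff set_rep_eq_Some)
qed

lemma computable_map_compact_rep_set_rep:
  assumes S: "computable_map (prod_rep nat_rep bit_rep) (open_rep X) (\<lambda>(n, i). Some (S n i))"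
      "dyadic_subbase X S" "proper_subbase X S"
    and X: "Hausdorff_space (rtop X)"
  shows "computable_map (compact_rep X) (set_rep X S \<circ>\<^sub>m plotkin_seq_rep) Some"
proof -
  have "semidecidable (compact_rep X) (\<lambda>A m. A \<subseteq> nth_exterior X S m)"
    by (rule semidecidable_compact_subset[OF semidecidable_nth_exterior[OF S(1)]]) blast
  then obtain R where R: "semirecursive R"
      "\<And>q A m. compact_rep X q = Some A \<Longrightarrow> R q m \<longleftrightarrow> A \<subseteq> nth_exterior X S m"
    by (rule semidecidableE) blast
  have "semirecursive (\<lambda>q n. odd n \<and> R q (n div 2))"
    by (intro semirecursive_conj semirecursive_comp[OF R(1)] semirecursive_recursive_pred
        recursive_intros)
  then have "semidecidable (compact_rep X) (\<lambda>A n. odd n \<and> A \<subseteq> nth_exterior X S (n div 2))"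
    by (rule semidecidableI) (simp add: R(2))
  from computable_map_plotkin_seq_rep[OF this, of False]
  have "computable_map (compact_rep X) plotkin_seq_rep (\<lambda>A. Some (exterior_name X S A))"
    by (simp add: exterior_name_def[abs_def])
  then show ?thesis
  proof (rule computable_map_codomain)
    fix t A
    assume A: "A \<in> ran (compact_rep X)" and t: "plotkin_seq_rep t = Some (exterior_name X S A)"
    have "compactin (rtop X) A"
      using A by (auto simp: ran_def compact_rep_eq_Some compact_name_def)
    with t show "(set_rep X S \<circ>\<^sub>m plotkin_seq_rep) t = Some A"
      by (simp add: set_rep_exterior_name[OF S(2,3) X])
  qed
qed

theorem theorem21:
  fixes X :: "'a rspace"
  assumes "computably_admissible X"
    and "computably_compact X"
    and "Hausdorff_space (rtop X)"
    and "\<exists>S. computable_dyadic_subbase X S \<and> proper_subbase X S"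
  shows "\<exists>(\<delta> :: 'a rspace) (\<psi> :: (nat \<Rightarrow> plotkin) \<rightharpoonup> 'a set).
    rep_equiv \<delta> X \<and>
    ran \<psi> = {A. compactin (rtop X) A} \<and>
    rep_equiv (\<psi> \<circ>\<^sub>m plotkin_seq_rep) (compact_rep X) \<and>
    (\<forall>A x. compactin (rtop X) A \<longrightarrow> x \<in> ran X \<longrightarrow>
      (x \<in> A \<longleftrightarrow>
        (\<forall>p. \<psi> p = Some A \<longrightarrow> (\<exists>q. p \<preceq>\<^sub>T total_seq q \<and> \<delta> q = Some x))) \<and>
      (x \<in> A \<longleftrightarrow>
        (\<exists>p. \<psi> p = Some A \<and> (\<exists>q. p \<preceq>\<^sub>T total_seq q \<and> \<delta> q = Some x))))"
proof -
  obtain S where "computable_dyadic_subbase X S" and proper: "proper_subbase X S"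
    using assms(4) by blast
  then have S: "dyadic_subbase X S"
    and computable: "computable_map (prod_rep nat_rep bit_rep) (open_rep X) (\<lambda>(n, i). Some (S n i))"
    by (simp_all only: computable_dyadic_subbase_def)
  show ?thesis
  proof (intro exI[of _ "point_rep X S"] exI[of _ "set_rep X S"] conjI allI impI)
    show "rep_equiv (point_rep X S) X"
      by (rule rep_equiv_point_rep)
    show ran: "ran (set_rep X S) = {A. compactin (rtop X) A}"
      by (rule ran_set_rep[OF S proper assms(3)])
    show "rep_equiv (set_rep X S \<circ>\<^sub>m plotkin_seq_rep) (compact_rep X)"
      using computable_map_set_rep_compact_rep[OF computable assms(2,3)]
        computable_map_compact_rep_set_rep[OF computable S proper assms(3)]
      by (simp add: rep_equiv_def)
    fix A x assume "compactin (rtop X) A" and x: "x \<in> ran X"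
    then obtain p where "set_rep X S p = Some A"
      using ran by (auto simp: ran_def)
    then show "x \<in> A \<longleftrightarrow>
        (\<forall>p. set_rep X S p = Some A \<longrightarrow> (\<exists>q. p \<preceq>\<^sub>T total_seq q \<and> point_rep X S q = Some x))"
      and "x \<in> A \<longleftrightarrow>
        (\<exists>p. set_rep X S p = Some A \<and> (\<exists>q. p \<preceq>\<^sub>T total_seq q \<and> point_rep X S q = Some x))"
      using mem_set_rep_iff_ex_refinement[OF _ x] by blast+
  qed
qed

end
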